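(* Let $N\ge 1$ and let $V_N\in U(N)$ be distributed according to the Haar probability measure $\mu_{U(N)}$ on the unitary group $U(N)$. Then for all $\theta\in\mathbb{R}$, $$\det(I_N-e^{\mathrm{i}\theta}V_N)\ \overset{\mathrm{law}}{=}\ \prod_{k=1}^N\left(1+e^{\mathrm{i}\theta_k}\sqrt{\beta_{1,k-1}}\right),$$ where $\theta_1,\dots,\theta_N,\beta_{1,0},\dots,\beta_{1,N-1}$ are independent random variables, each $\theta_k$ is uniformly distributed on $[0,2\pi]$, and each $\beta_{1,j}$ ($0\le j\le N-1$) is beta distributed with parameters $1$ and $j$ (by convention, $\beta_{1,0}$ has the Dirac distribution at $1$).
   Context: $\overset{\mathrm{law}}{=}$ denotes equality in distribution. A beta random variable with parameters $a,b>0$ has density $\frac{\Gamma(a+b)}{\Gamma(a)\Gamma(b)}t^{a-1}(1-t)^{b-1}$ on $[0,1]$. *)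

theory Defs
  imports "HOL-Probability.Probability"
begin

definition conj_transpose :: "complex ^ 'n ^ 'm \<Rightarrow> complex ^ 'm ^ 'n" where
  "conj_transpose A = (\<chi> i j. cnj (A $ j $ i))"

definition unitary_group :: "(complex ^ 'n ^ 'n) set" where
  "unitary_group = {U. U ** conj_transpose U = mat 1 \<and> conj_transpose U ** U = mat 1}"

definition unitary_borel :: "(complex ^ 'n ^ 'n) measure" where
  "unitary_borel = restrict_space borel unitary_group"

text \<open>
  The Haar probability measure is characterised as the left-invariant Borel probability measure on
  the unitary group. Regularity is automatic (the group is a compact metric space), and on a
  compact group left invariance determines the measure and implies right invariance. Invariance is
  expressed by the push-forward under left translation by \<open>U\<close>.
\<close>
definition is_unitary_haar :: "(complex ^ 'n ^ 'n) measure \<Rightarrow> bool" where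
  "is_unitary_haar \<mu> \<longleftrightarrow>
     prob_space \<mu> \<and> space \<mu> = unitary_group \<and> sets \<mu> = sets unitary_borel \<and>
     (\<forall>U\<in>unitary_group. distr \<mu> unitary_borel (\<lambda>X. U ** X) = \<mu>)"

text \<open>
  In \<open>powr\<close> we have \<open>0 powr 0 = 0\<close>, which may affect the density only at the end points \<open>0\<close> and
  \<open>1\<close>, a Lebesgue null set.
\<close>
definition beta_density :: "real \<Rightarrow> real \<Rightarrow> real \<Rightarrow> real" where
  "beta_density a b t =
     Gamma (a + b) / (Gamma a * Gamma b) * t powr (a - 1) * (1 - t) powr (b - 1)
       * indicator {0..1} t"

definition beta_measure :: "real \<Rightarrow> real \<Rightarrow> real measure" where
  "beta_measure a b = density lborel (\<lambda>t. ennreal (beta_density a b t))"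

text \<open>The law of \<open>\<beta>\<^sub>1\<^sub>,\<^sub>j\<close>, which for \<open>j = 0\<close> is by convention the Dirac distribution at \<open>1\<close>.\<close>
definition beta1_law :: "nat \<Rightarrow> real measure" where
  "beta1_law j = (if j = 0 then return borel 1 else beta_measure 1 (real j))"

end

theory Submission
  imports Defs
begin

text \<open>
  Let \<open>x\<close> be uniform on the unit sphere of \<open>\<complex>\<^sup>S\<close>, \<open>R\<close> the complex reflection mapping the basis
  vector \<open>e\<^sub>i\<close> to \<open>x\<close>, and \<open>W\<close> an independent Haar matrix of the group of unitary matrices that are
  the identity outside the block \<open>S - {i}\<close>. Then \<open>R W\<close> is Haar distributed on the group belonging to
  \<open>S\<close>: for \<open>U\<close> in that group, \<open>U R\<^sub>x = R\<^sub>U\<^sub>x K\<close> with \<open>K\<close> fixing \<open>e\<^sub>i\<close>, and \<open>K\<close> is absorbed by \<open>W\<close>.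
  Since \<open>R\<close> is a rank one perturbation of the identity, the characteristic determinant of \<open>R W\<close> is
  \<open>(1 - x\<^sub>i)\<close> times that of \<open>W\<close>. Realising \<open>x\<close> as a normalised Gaussian vector shows that \<open>x\<^sub>i\<close> has a
  uniform phase and that \<open>\<bar>x\<^sub>i\<bar>\<^sup>2\<close>, a quotient of exponential variables, is beta distributed. Working
  with index subsets \<open>S\<close> of a fixed type lets the induction on the dimension run inside \<open>U(N)\<close>.
\<close>

subsection \<open>Unitary matrices and complex reflections\<close>

lemma conj_transpose_nth [simp]: "conj_transpose A $ k $ l = cnj (A $ l $ k)"
  by (simp add: conj_transpose_def)

lemma conj_transpose_conj_transpose [simp]: "conj_transpose (conj_transpose A) = A"
  by (simp add: vec_eq_iff)

lemma conj_transpose_mult: "conj_transpose (A ** B) = conj_transpose B ** conj_transpose A"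
  by (simp add: vec_eq_iff matrix_matrix_mult_def mult.commute)

lemma conj_transpose_mat_1 [simp]: "conj_transpose (mat 1) = mat 1"
  by (simp add: vec_eq_iff mat_def)

lemma unitary_group_conj_transpose: "U \<in> unitary_group \<Longrightarrow> conj_transpose U \<in> unitary_group"
  by (simp add: unitary_group_def)

lemma unitary_group_mult:
  assumes "U \<in> unitary_group" "V \<in> unitary_group"
  shows "U ** V \<in> unitary_group"
proof -
  have "U ** V ** (conj_transpose V ** conj_transpose U) = U ** (V ** conj_transpose V) ** conj_transpose U"
    "conj_transpose V ** conj_transpose U ** (U ** V) = conj_transpose V ** (conj_transpose U ** U) ** V"
    by (simp_all add: matrix_mul_assoc)
  then show ?thesis
    using assms by (simp add: unitary_group_def conj_transpose_mult)
qed

lemma unitary_groupI: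
  fixes U :: "complex ^ 'n ^ 'n"
  shows "U ** conj_transpose U = mat 1 \<Longrightarrow> U \<in> unitary_group"
  using matrix_left_right_inverse[of U "conj_transpose U"] by (simp add: unitary_group_def)

lemma norm_vec_sq_real: "(norm x)\<^sup>2 = (\<Sum>k\<in>UNIV. (norm (x $ k))\<^sup>2)"
  by (simp add: norm_vec_def L2_set_def sum_nonneg)

lemma norm_vec_sq: "complex_of_real ((norm x)\<^sup>2) = (\<Sum>k\<in>UNIV. cnj (x $ k) * x $ k)"
  for x :: "complex ^ 'n"
  unfolding norm_vec_sq_real
  by (simp only: of_real_sum complex_norm_square) (simp add: mult.commute)

lemma unitary_norm:
  assumes "U \<in> unitary_group"
  shows "norm (U *v x) = norm x"
proof -
  have "complex_of_real ((norm (U *v x))\<^sup>2)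
      = (\<Sum>k\<in>UNIV. \<Sum>l\<in>UNIV. \<Sum>m\<in>UNIV. cnj (U $ k $ l) * cnj (x $ l) * (U $ k $ m * x $ m))"
    unfolding norm_vec_sq by (simp add: matrix_vector_mult_def sum_product)
  also have "\<dots> = (\<Sum>l\<in>UNIV. \<Sum>m\<in>UNIV. \<Sum>k\<in>UNIV. cnj (U $ k $ l) * cnj (x $ l) * (U $ k $ m * x $ m))"
    by (subst sum.swap, rule sum.cong[OF refl], rule sum.swap)
  also have "\<dots> = (\<Sum>l\<in>UNIV. \<Sum>m\<in>UNIV. cnj (x $ l) * x $ m * (conj_transpose U ** U) $ l $ m)"
    by (simp add: matrix_matrix_mult_def sum_distrib_left mult_ac)
  also have "\<dots> = (\<Sum>l\<in>UNIV. \<Sum>m\<in>UNIV. if l = m then cnj (x $ l) * x $ m else 0)"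
    using assms by (intro sum.cong) (auto simp: unitary_group_def mat_def)
  also have "\<dots> = complex_of_real ((norm x)\<^sup>2)"
    unfolding norm_vec_sq by simp
  finally show ?thesis
    by (simp only: of_real_eq_iff) simp
qed

definition fix_unitary :: "'n set \<Rightarrow> (complex ^ 'n ^ 'n) set" where
  "fix_unitary S = {U \<in> unitary_group. \<forall>k l. k \<notin> S \<or> l \<notin> S \<longrightarrow> U $ k $ l = (if k = l then 1 else 0)}"

lemma fix_unitary_UNIV [simp]: "fix_unitary UNIV = unitary_group"
  by (simp add: fix_unitary_def)

lemma fix_unitary_unitary: "U \<in> fix_unitary S \<Longrightarrow> U \<in> unitary_group"
  by (simp add: fix_unitary_def)

lemma matrix_vector_axis: "(A *v axis j 1) $ k = A $ k $ j"
  for A :: "complex ^ 'n ^ 'm"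
  by (simp add: matrix_vector_mult_def axis_def if_distrib cong: if_cong)

text \<open>Fixed basis vectors determine the columns outside \<open>S\<close>; unitarity supplies
  the rows, since entry (j, l) of \<open>conj_transpose U ** U\<close> is the inner product of the
  basis column j with column l, which is \<open>U $ j $ l\<close>.\<close>

lemma fix_unitaryI:
  assumes U: "U \<in> unitary_group" and fix1: "\<And>j. j \<notin> S \<Longrightarrow> U *v axis j 1 = axis j 1"
  shows "U \<in> fix_unitary S"
proof -
  have col: "U $ k $ j = (if k = j then 1 else 0)" if "j \<notin> S" for k j
    using arg_cong[OF fix1[OF that], of "\<lambda>v. v $ k"]
    by (simp only: matrix_vector_axis) (simp add: axis_def)
  have "U $ j $ l = (if j = l then 1 else 0)" if "j \<notin> S" for j l
  proof -
    have "(conj_transpose U ** U) $ j $ l = (\<Sum>k\<in>UNIV. (if k = j then U $ k $ l else 0))"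
      unfolding matrix_matrix_mult_def vec_lambda_beta
      by (intro sum.cong) (use that in \<open>auto simp: col\<close>)
    also have "\<dots> = U $ j $ l" by simp
    finally show ?thesis
      using U by (simp add: unitary_group_def mat_def)
  qed
  then show ?thesis using U col by (auto simp: fix_unitary_def)
qed

lemma fix_unitary_axis: "U \<in> fix_unitary S \<Longrightarrow> j \<notin> S \<Longrightarrow> U *v axis j 1 = axis j 1"
  by (simp add: vec_eq_iff matrix_vector_axis) (simp add: fix_unitary_def axis_def)

lemma fix_unitary_mult:
  assumes "U \<in> fix_unitary S" "V \<in> fix_unitary S"
  shows "U ** V \<in> fix_unitary S"
  using assms
  by (intro fix_unitaryI unitary_group_mult)
     (auto simp: fix_unitary_unitary fix_unitary_axis simp flip: matrix_vector_mul_assoc)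

lemma fix_unitary_conj_transpose:
  "U \<in> fix_unitary S \<Longrightarrow> conj_transpose U \<in> fix_unitary S"
  by (auto simp: fix_unitary_def unitary_group_conj_transpose)

lemma fix_unitary_mono: "S \<subseteq> T \<Longrightarrow> fix_unitary S \<subseteq> fix_unitary T"
  by (auto simp: fix_unitary_def)

definition coord_proj :: "'n set \<Rightarrow> complex ^ 'n \<Rightarrow> complex ^ 'n" where
  "coord_proj S x = (\<chi> k. if k \<in> S then x $ k else 0)"

lemma coord_proj_fix_unitary:
  assumes "U \<in> fix_unitary S"
  shows "coord_proj S (U *v x) = U *v coord_proj S x"
proof -
  have *: "U $ k $ l = (if k = l then 1 else 0)" if "k \<notin> S \<or> l \<notin> S" for k l
    using assms that by (auto simp: fix_unitary_def)
  have "(if k \<in> S then \<Sum>l\<in>UNIV. U $ k $ l * x $ l else 0)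
      = (\<Sum>l\<in>UNIV. U $ k $ l * (if l \<in> S then x $ l else 0))" for k
  proof (cases "k \<in> S")
    case True
    then show ?thesis by (auto simp: * intro!: sum.cong)
  next
    case False
    then have "(\<Sum>l\<in>UNIV. U $ k $ l * (if l \<in> S then x $ l else 0)) = 0"
      by (intro sum.neutral) (auto simp: *)
    with False show ?thesis by simp
  qed
  then show ?thesis
    unfolding coord_proj_def vec_eq_iff matrix_vector_mult_def vec_lambda_beta by blast
qed

text \<open>The zero vector is sent to a unit vector as well, so that every value lies on the sphere.\<close>
definition normalise :: "'n \<Rightarrow> complex ^ 'n \<Rightarrow> complex ^ 'n" where
  "normalise i v = (if v = 0 then axis i 1 else (1 / norm v) *\<^sub>R v)"

lemma norm_normalise [simp]: "norm (normalise i v) = 1"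
  by (simp add: normalise_def)

text \<open>The default value \<open>axis i 1\<close> at zero does not move along with
  \<open>U\<close>, so zero has to be excluded; for Gaussian vectors this costs only a null
  set.\<close>

lemma normalise_unitary:
  assumes "U \<in> unitary_group" "v \<noteq> 0"
  shows "normalise i (U *v v) = U *v normalise i v"
proof -
  have "U *v v \<noteq> 0"
    using unitary_norm[OF assms(1), of v] assms(2) by auto
  moreover have "U *v (c *\<^sub>R v) = c *\<^sub>R (U *v v)" for c
    by (simp add: vec_eq_iff matrix_vector_mult_def scaleR_sum_right)
  ultimately show ?thesis
    using assms by (simp add: normalise_def unitary_norm)
qed

text \<open>The complex reflection that maps \<open>axis i 1\<close> to the unit vector \<open>x\<close>. For \<open>x = axis i 1\<close> the
  numerator vanishes, so division by zero yields the identity matrix, as it should.\<close>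
definition reflect :: "'n \<Rightarrow> complex ^ 'n \<Rightarrow> complex ^ 'n ^ 'n" where
  "reflect i x = (\<chi> k l. (if k = l then 1 else 0)
     - (x - axis i 1) $ k * cnj ((x - axis i 1) $ l) / (1 - cnj (x $ i)))"

text \<open>Settles the degenerate case of \<open>reflect\<close>, where the denominator
  vanishes.\<close>

lemma unit_vec_eq_axis:
  fixes x :: "complex ^ 'n"
  assumes "norm x = 1" "x $ i = 1"
  shows "x = axis i 1"
proof -
  have "(\<Sum>k\<in>UNIV. (norm (x $ k))\<^sup>2) = 1"
    using assms(1) norm_vec_sq_real[of x] by simp
  moreover have "(\<Sum>k\<in>UNIV. (norm (x $ k))\<^sup>2) = (norm (x $ i))\<^sup>2 + (\<Sum>k\<in>UNIV - {i}. (norm (x $ k))\<^sup>2)"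
    by (simp add: sum.remove)
  ultimately have "(\<Sum>k\<in>UNIV - {i}. (norm (x $ k))\<^sup>2) = 0"
    using assms(2) by simp
  then have "x $ k = 0" if "k \<noteq> i" for k
    using that by (subst (asm) sum_nonneg_eq_0_iff) auto
  then show ?thesis using assms(2) by (simp add: vec_eq_iff axis_def)
qed

text \<open>With v = x - e_i and a = 1 / (1 - cnj x_i) the matrix is R = 1 - a v v^H, so R R^H = 1 +
  (|a|^2 |v|^2 - a - cnj a) v v^H. As |x| = 1, |v|^2 = 2 - x_i - cnj x_i = 1/a + 1/cnj a, and the
  bracket vanishes.\<close>

lemma reflect_unitary:
  fixes x :: "complex ^ 'n"
  assumes x: "norm x = 1"
  shows "reflect i x \<in> unitary_group"
proof (cases "x $ i = 1")
  case True
  then have "reflect i x = mat 1"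
    using unit_vec_eq_axis[OF x] by (simp add: reflect_def vec_eq_iff mat_def)
  then show ?thesis by (simp add: unitary_group_def)
next
  case False
  define v where "v = x - axis i 1"
  define a where "a = 1 / (1 - cnj (x $ i))"
  have nz: "1 - cnj (x $ i) \<noteq> 0" "1 - x $ i \<noteq> 0"
    using False by (metis complex_cnj_cancel_iff complex_cnj_one right_minus_eq) (use False in simp)
  have cv: "(\<Sum>l\<in>UNIV. cnj (v $ l) * v $ l) = 2 - x $ i - cnj (x $ i)"
  proof -
    have "(\<Sum>l\<in>UNIV. cnj (v $ l) * v $ l)
       = (\<Sum>l\<in>UNIV. cnj (x $ l) * x $ l + (if l = i then 1 - x $ i - cnj (x $ i) else 0))"
      by (intro sum.cong) (auto simp: v_def axis_def algebra_simps)
    also have "\<dots> = 2 - x $ i - cnj (x $ i)"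
      using norm_vec_sq[of x] x by (simp add: sum.distrib)
    finally show ?thesis .
  qed
  have cnj_if: "cnj (if P then 1 else 0) = (if P then 1 else 0)" for P
    by simp
  have R: "reflect i x = (\<chi> k l. (if k = l then 1 else 0) - a * v $ k * cnj (v $ l))"
    by (simp add: reflect_def a_def v_def)
  have "(\<Sum>l\<in>UNIV. ((if k = l then 1 else 0) - a * v $ k * cnj (v $ l))
            * ((if m = l then 1 else 0) - cnj a * cnj (v $ m) * v $ l))
       = (if k = m then 1 else 0)" (is "?L = _") for k m
  proof -
    have "?L = (\<Sum>l\<in>UNIV. (if l = k then (if k = m then 1 else 0) - cnj a * cnj (v $ m) * v $ k else 0)
          - (if l = m then a * v $ k * cnj (v $ m) else 0)
          + a * cnj a * v $ k * cnj (v $ m) * (cnj (v $ l) * v $ l))"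
      by (intro sum.cong) (auto simp: algebra_simps)
    also have "\<dots> = (if k = m then 1 else 0) - cnj a * cnj (v $ m) * v $ k - a * v $ k * cnj (v $ m)
          + a * cnj a * v $ k * cnj (v $ m) * (2 - x $ i - cnj (x $ i))"
      by (simp add: sum.distrib sum_subtractf cv flip: sum_distrib_left)
    also have "\<dots> = (if k = m then 1 else 0)
          + v $ k * cnj (v $ m) * (a * cnj a * (2 - x $ i - cnj (x $ i)) - a - cnj a)"
      by (simp add: algebra_simps)
    also have "a * cnj a * (2 - x $ i - cnj (x $ i)) - a - cnj a = 0"
    proof -
      have "2 - x $ i - cnj (x $ i) = (1 - x $ i) + (1 - cnj (x $ i))" by simp
      moreover have "cnj a = 1 / (1 - x $ i)" by (simp add: a_def)
      ultimately have "a * cnj a * (2 - x $ i - cnj (x $ i))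
          = (a * (1 - cnj (x $ i))) * cnj a + (cnj a * (1 - x $ i)) * a"
        by (simp only: distrib_left mult_ac add.commute)
      moreover have "a * (1 - cnj (x $ i)) = 1" "cnj a * (1 - x $ i) = 1"
        using nz by (simp_all add: a_def)
      ultimately show ?thesis by simp
    qed
    finally show ?thesis by simp
  qed
  then have "reflect i x ** conj_transpose (reflect i x) = mat 1"
    unfolding R vec_eq_iff matrix_matrix_mult_def mat_def
    by (simp add: cnj_if)
  then show ?thesis by (rule unitary_groupI)
qed

text \<open>In the regular case a v^H e_i = -1, so e_i is sent to e_i + v = x.\<close>

lemma reflect_axis_self:
  assumes "norm x = 1"
  shows "reflect i x *v axis i 1 = x"
proof (cases "x $ i = 1")
  case True
  then show ?thesis
    using unit_vec_eq_axis[OF assms]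
    by (simp add: vec_eq_iff matrix_vector_axis) (simp add: reflect_def axis_def)
next
  case False
  then have "1 - cnj (x $ i) \<noteq> 0"
    by (metis complex_cnj_cancel_iff complex_cnj_one right_minus_eq)
  then have "z * (cnj (x $ i) - 1) / (1 - cnj (x $ i)) = - z" for z
    by (simp add: divide_eq_eq algebra_simps)
  then show ?thesis
    unfolding vec_eq_iff matrix_vector_axis by (simp add: reflect_def axis_def)
qed

lemma reflect_axis_other:
  assumes "j \<noteq> i" "x $ j = 0"
  shows "reflect i x *v axis j 1 = axis j 1"
  using assms by (simp add: vec_eq_iff matrix_vector_axis) (simp add: reflect_def axis_def)

lemma reflect_fix_unitary:
  assumes "norm x = 1" "\<And>j. j \<notin> S \<Longrightarrow> x $ j = 0" "i \<in> S"
  shows "reflect i x \<in> fix_unitary S"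
  using assms by (intro fix_unitaryI reflect_unitary reflect_axis_other) auto

lemma reflect_cocycle:
  assumes U: "U \<in> fix_unitary (insert i S)" and iS: "i \<notin> S"
    and x: "norm x = 1" "\<And>j. j \<notin> insert i S \<Longrightarrow> x $ j = 0"
  shows "\<exists>K\<in>fix_unitary S. U ** reflect i x = reflect i (U *v x) ** K"
proof
  let ?y = "U *v x"
  \<comment> \<open>This product carries e_i to x, then to \<open>U *v x\<close>, and back to e_i;
    hence it fixes e_i besides the basis vectors outside \<open>insert i S\<close>.\<close>
  let ?K = "conj_transpose (reflect i ?y) ** (U ** reflect i x)"
  have y: "norm ?y = 1"
    using U x by (simp add: unitary_norm fix_unitary_unitary)
  have px: "coord_proj (insert i S) x = x"
    using x(2) by (auto simp: coord_proj_def vec_eq_iff)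
  have "coord_proj (insert i S) ?y = ?y"
    using coord_proj_fix_unitary[OF U, of x] px by simp
  then have y0: "?y $ j = 0" if "j \<notin> insert i S" for j
    using that unfolding coord_proj_def vec_eq_iff vec_lambda_beta by metis
  have Ry: "reflect i ?y \<in> fix_unitary (insert i S)"
    using y y0 by (intro reflect_fix_unitary) auto
  have Rx: "reflect i x \<in> fix_unitary (insert i S)"
    using x by (intro reflect_fix_unitary) auto
  have RR: "conj_transpose (reflect i ?y) ** reflect i ?y = mat 1"
    "reflect i ?y ** conj_transpose (reflect i ?y) = mat 1"
    using fix_unitary_unitary[OF Ry] by (auto simp: unitary_group_def)
  have K: "?K \<in> fix_unitary (insert i S)"
    using U Rx Ry by (intro fix_unitary_mult fix_unitary_conj_transpose)
  show "?K \<in> fix_unitary S"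
  proof (rule fix_unitaryI)
    show "?K \<in> unitary_group" using K by (rule fix_unitary_unitary)
  next
    fix j assume "j \<notin> S"
    show "?K *v axis j 1 = axis j 1"
    proof (cases "j = i")
      case True
      have "?K *v axis i 1 = conj_transpose (reflect i ?y) *v ?y"
        using x by (simp add: reflect_axis_self flip: matrix_vector_mul_assoc)
      also have "\<dots> = (conj_transpose (reflect i ?y) ** reflect i ?y) *v axis i 1"
        using y by (simp add: reflect_axis_self flip: matrix_vector_mul_assoc)
      finally show ?thesis using True RR by simp
    next
      case False
      with \<open>j \<notin> S\<close> show ?thesis by (intro fix_unitary_axis[OF K]) auto
    qed
  qed
  show "U ** reflect i x = reflect i ?y ** ?K"
    by (simp add: matrix_mul_assoc RR)
qed

section \<open>Determinants under multiplication by a reflection\<close>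

lemma det_unit_columns:
  fixes B :: "'a::comm_ring_1 ^ 'n ^ 'n"
  assumes "\<And>k l. l \<noteq> i \<Longrightarrow> B $ k $ l = (if k = l then 1 else 0)"
  shows "det B = B $ i $ i"
proof -
  \<comment> \<open>In the Leibniz formula a permutation other than the identity has a moved point m
    with p m \<noteq> i, and its factor is an off-diagonal entry of a unit column. If the first
    moved point found goes to i, then i itself is moved and serves as m.\<close>
  have "(\<Prod>k\<in>UNIV. B $ k $ p k) = 0" if p: "p permutes UNIV" "p \<noteq> id" for p
  proof -
    from p(2) obtain k where k: "p k \<noteq> k" by (auto simp: fun_eq_iff)
    have inj: "inj p" using p(1) by (rule permutes_inj)
    obtain m where "p m \<noteq> m" "p m \<noteq> i"
    proof (cases "p k = i")
      case True
      then have "p i \<noteq> i" using k injD[OF inj, of k i] by auto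
      then show ?thesis using that[of i] by simp
    qed (use k that in blast)
    then have "B $ m $ p m = 0" using assms[of "p m" m] by simp
    then show ?thesis by (intro prod_zero) auto
  qed
  then have "det B = (\<Sum>p\<in>{id}. of_int (sign p) * (\<Prod>k\<in>UNIV. B $ k $ p k))"
    unfolding det_def by (intro sum.mono_neutral_right) simp_all
  also have "\<dots> = (\<Prod>k\<in>UNIV. if k = i then B $ i $ i else 1)"
  proof -
    have "B $ k $ k = (if k = i then B $ i $ i else 1)" for k
      using assms[of k k] by simp
    then have "(\<Prod>k\<in>UNIV. B $ k $ k) = (\<Prod>k\<in>UNIV. if k = i then B $ i $ i else 1)"
      by (intro prod.cong refl)
    then show ?thesis by simp
  qed
  also have "\<dots> = B $ i $ i" by simp
  finally show ?thesis .
qed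

text \<open>For \<open>W \<in> fix_unitary S\<close> this is the characteristic determinant of the \<open>S \<times> S\<close> block of \<open>W\<close>.\<close>
definition minor_det :: "'n set \<Rightarrow> complex ^ 'n ^ 'n \<Rightarrow> complex" where
  "minor_det S W = det (\<chi> k l. (if k = l then 1 else 0) - (if l \<in> S then W $ k $ l else 0))"

lemma minor_det_empty [simp]: "minor_det {} W = 1"
  unfolding minor_det_def using det_I by (simp add: mat_def)

lemma minor_det_UNIV: "minor_det UNIV W = det (mat 1 - W)"
  unfolding minor_det_def by (rule arg_cong[of _ _ det]) (simp add: vec_eq_iff mat_def)

text \<open>The matrix on the left factors as G C F, where C is the matrix of
  \<open>minor_det S W\<close>. Column i of 1 - R W is e_i - x = -v, because W fixes e_i and R sends
  it to x; every other column is that of C up to a multiple of v. \<open>G\<close> inserts the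
  column -v and has determinant 1 - x_i, while \<open>F\<close> is a column operation of determinant
  1.\<close>

lemma minor_det_reflect:
  fixes x :: "complex ^ 'n"
  assumes W: "W \<in> fix_unitary S" and iS: "i \<notin> S" and x: "norm x = 1"
  shows "minor_det (insert i S) (reflect i x ** W) = (1 - x $ i) * minor_det S W"
proof -
  define v where "v = x - axis i 1"
  define a where "a = 1 / (1 - cnj (x $ i))"
  define w where "w l = (if l \<in> S then - a * (\<Sum>m\<in>UNIV. cnj (v $ m) * W $ m $ l) else 0)" for l
  define C where "C = (\<chi> k l. (if k = l then 1 else 0) - (if l \<in> S then W $ k $ l else 0))"
  define G :: "complex ^ 'n ^ 'n" where "G = (\<chi> k l. if l = i then - v $ k else if k = l then 1 else 0)"
  define F :: "complex ^ 'n ^ 'n" where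
    "F = (\<chi> k l. if k = l then 1 else if k = i then w l else 0)"
  have Wi: "W $ k $ l = (if k = l then 1 else 0)" if "k = i \<or> l = i" for k l
    using W iS that by (auto simp: fix_unitary_def)
  \<comment> \<open>The degenerate case holds because v = 0 there.\<close>
  have av: "a * v $ k * cnj (v $ i) = - v $ k" for k
  proof (cases "x $ i = 1")
    case True
    then show ?thesis using unit_vec_eq_axis[OF x] by (simp add: v_def)
  next
    case False
    then have "1 - cnj (x $ i) \<noteq> 0"
      by (metis complex_cnj_cancel_iff complex_cnj_one right_minus_eq)
    then show ?thesis by (simp add: a_def v_def field_simps)
  qed
  have RW: "(reflect i x ** W) $ k $ l = W $ k $ l - a * v $ k * (\<Sum>m\<in>UNIV. cnj (v $ m) * W $ m $ l)" for k l
  proof -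
    have "(reflect i x ** W) $ k $ l
        = (\<Sum>m\<in>UNIV. (if m = k then W $ m $ l else 0) - a * v $ k * (cnj (v $ m) * W $ m $ l))"
    proof -
      have "reflect i x $ k $ m = (if k = m then 1 else 0) - a * v $ k * cnj (v $ m)" for m
        by (simp add: reflect_def a_def v_def)
      then show ?thesis
        unfolding matrix_matrix_mult_def by (auto simp: left_diff_distrib mult.assoc intro!: sum.cong)
    qed
    then show ?thesis by (simp add: sum_subtractf sum_distrib_left)
  qed
  \<comment> \<open>Row and column i of \<open>C\<close> are those of the identity, so
    multiplication by \<open>G\<close> replaces column i and leaves the rest.\<close>
  have GC: "(G ** C) $ k $ l = (if l = i then - v $ k else C $ k $ l)" for k l
  proof -
    have Ci: "C $ m $ l = (if m = l then 1 else 0)" if "m = i \<or> l = i" for m l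
      using that iS by (auto simp: C_def Wi)
    have "(G ** C) $ k $ l = (\<Sum>m\<in>UNIV. (if m = i then - v $ k * C $ m $ l else 0)
            + (if m = k then (if k = i then 0 else C $ m $ l) else 0))"
      unfolding matrix_matrix_mult_def by (auto simp: G_def intro!: sum.cong)
    also have "\<dots> = (if l = i then - v $ k else C $ k $ l)"
      by (auto simp: sum.distrib Ci)
    finally show ?thesis .
  qed
  \<comment> \<open>\<open>F\<close> adds \<open>w l\<close> times column i, which is now -v, to
    each other column l.\<close>
  have "((G ** C) ** F) $ k $ l = (if l = i then - v $ k else C $ k $ l - v $ k * w l)" for k l
  proof -
    have "((G ** C) ** F) $ k $ l = (\<Sum>m\<in>UNIV. (if m = l then (G ** C) $ k $ m else 0)
         + (if m = i then (if l = i then 0 else (G ** C) $ k $ m * w l) else 0))"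
      unfolding matrix_matrix_mult_def[of "G ** C"] by (auto simp: F_def intro!: sum.cong)
    then show ?thesis by (simp add: sum.distrib GC)
  qed
  moreover have "(if k = l then 1 else 0) - (if l \<in> insert i S then (reflect i x ** W) $ k $ l else 0)
      = (if l = i then - v $ k else C $ k $ l - v $ k * w l)" for k l
  proof (cases "l = i")
    case True
    have "(\<Sum>m\<in>UNIV. cnj (v $ m) * W $ m $ i) = (\<Sum>m\<in>UNIV. if m = i then cnj (v $ m) else 0)"
      by (intro sum.cong) (auto simp: Wi)
    then have "(reflect i x ** W) $ k $ i = (if k = i then 1 else 0) + v $ k"
      using av[of k] by (simp add: RW Wi)
    with True show ?thesis by simp
  next
    case False
    then show ?thesis by (simp add: RW C_def w_def)
  qed
  ultimately have eq: "(\<chi> k l. (if k = l then 1 else 0)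
      - (if l \<in> insert i S then (reflect i x ** W) $ k $ l else 0)) = (G ** C) ** F"
    by (simp add: vec_eq_iff)
  have "det G = 1 - x $ i"
    by (subst det_unit_columns[where i = i]) (auto simp: G_def v_def)
  moreover have "det F = 1"
    by (subst det_transpose[symmetric], subst det_unit_columns[where i = i])
       (auto simp: F_def transpose_def)
  ultimately show ?thesis
    unfolding minor_det_def eq by (simp add: det_mul C_def)
qed

subsection \<open>Lebesgue measure and orthogonal maps\<close>

lemma borel_measurable_vec_nth [measurable]:
  "(\<lambda>x :: 'a::euclidean_space ^ 'n. x $ i) \<in> borel_measurable borel"
  by (intro borel_measurable_continuous_onI continuous_intros)

lemma borel_measurable_vecI:
  fixes f :: "'b \<Rightarrow> 'a::euclidean_space ^ 'n"
  assumes "\<And>i. (\<lambda>x. f x $ i) \<in> borel_measurable M"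
  shows "f \<in> borel_measurable M"
  unfolding borel_measurable_euclidean_space[of f]
proof
  fix b :: "'a ^ 'n" assume "b \<in> Basis"
  then obtain i u where "b = axis i u" by (auto simp: Basis_vec_def)
  then show "(\<lambda>x. f x \<bullet> b) \<in> borel_measurable M"
    using assms[of i] by (simp add: inner_axis)
qed

text \<open>The pull-back of Lebesgue measure is translation invariant and gives the unit ball the same
  mass; integrating \<open>indicator A (x + T y) * indicator (ball 0 1) x\<close> in both orders then shows
  that it agrees with Lebesgue measure on \<open>A\<close>.\<close>
lemma lborel_distr_orthogonal:
  fixes T :: "'a::euclidean_space \<Rightarrow> 'a"
  assumes "orthogonal_transformation T"
  shows "distr lborel borel T = lborel"
proof (rule measure_eqI)
  have lin: "linear T" and nrm: "\<And>x. norm (T x) = norm x"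
    using assms by (auto simp: orthogonal_transformation)
  have [measurable]: "T \<in> borel_measurable borel"
    using lin by (intro borel_measurable_continuous_onI linear_continuous_on) (simp add: linear_linear)
  let ?B = "ball (0::'a) 1"
  have [measurable]: "?B \<in> sets borel" by simp
  fix A :: "'a set" assume "A \<in> sets (distr lborel borel T)"
  then have [measurable]: "A \<in> sets borel" by simp
  have trans: "(\<integral>\<^sup>+y. f (y + c) \<partial>lborel) = (\<integral>\<^sup>+y. f y \<partial>lborel)"
    if [measurable]: "f \<in> borel_measurable borel" for f :: "'a \<Rightarrow> ennreal" and c
  proof -
    have "(\<integral>\<^sup>+y. f (c + y) \<partial>lborel) = (\<integral>\<^sup>+y. f y \<partial>distr lborel borel ((+) c))"
      by (simp add: nn_integral_distr)
    then show ?thesis by (simp add: lborel_distr_plus add.commute)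
  qed
  \<comment> \<open>Take c as a preimage of x: shifts of the value become shifts of the argument,
    which Lebesgue measure ignores.\<close>
  have ptrans: "\<exists>c. \<forall>y. T y + x = T (y + c)" for x
    using orthogonal_transformation_surj[OF assms] lin by (metis linear_add surjD)
  have "emeasure lborel A * emeasure lborel ?B
      = (\<integral>\<^sup>+x. indicator A x * emeasure lborel ?B \<partial>lborel)"
    by (simp add: nn_integral_multc)
  also have "\<dots> = (\<integral>\<^sup>+x. \<integral>\<^sup>+y. indicator A x * indicator ?B (x - T y) \<partial>lborel \<partial>lborel)"
  proof (rule nn_integral_cong)
    fix x
    obtain c where c: "\<And>y. T y + (-x) = T (y + c)" using ptrans[of "-x"] by blast
    have "x - T y \<in> ?B \<longleftrightarrow> y + c \<in> ?B" for y
      using c[of y] nrm[of "y + c"] norm_minus_commute[of x "T y"] by simp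
    then have "(\<integral>\<^sup>+y. indicator ?B (x - T y) \<partial>lborel) = (\<integral>\<^sup>+y. indicator ?B (y + c) \<partial>lborel)"
      by (intro nn_integral_cong) (auto split: split_indicator)
    also have "\<dots> = emeasure lborel ?B"
      by (subst trans) (auto intro: borel_measurable_indicator)
    finally have "(\<integral>\<^sup>+y. indicator ?B (x - T y) \<partial>lborel) = emeasure lborel ?B" .
    moreover have "(\<lambda>y. indicator ?B (x - T y) :: ennreal) \<in> borel_measurable lborel" by measurable
    ultimately show "indicator A x * emeasure lborel ?B
        = (\<integral>\<^sup>+y. indicator A x * indicator ?B (x - T y) \<partial>lborel)"
      by (simp add: nn_integral_cmult)
  qed
  also have "\<dots> = (\<integral>\<^sup>+y. \<integral>\<^sup>+x. indicator A x * indicator ?B (x - T y) \<partial>lborel \<partial>lborel)"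
    by (rule lborel_pair.Fubini') measurable
  also have "\<dots> = (\<integral>\<^sup>+y. \<integral>\<^sup>+x. indicator A (x + T y) * indicator ?B x \<partial>lborel \<partial>lborel)"
  proof (rule nn_integral_cong)
    fix y
    have "(\<lambda>x. indicator A x * indicator ?B (x - T y) :: ennreal) \<in> borel_measurable borel"
      by measurable
    from trans[OF this, of "T y"]
    show "(\<integral>\<^sup>+x. indicator A x * indicator ?B (x - T y) \<partial>lborel)
        = (\<integral>\<^sup>+x. indicator A (x + T y) * indicator ?B x \<partial>lborel)"
      by simp
  qed
  also have "\<dots> = (\<integral>\<^sup>+x. \<integral>\<^sup>+y. indicator A (x + T y) * indicator ?B x \<partial>lborel \<partial>lborel)"
    by (rule lborel_pair.Fubini') measurable
  also have "\<dots> = (\<integral>\<^sup>+x. emeasure (distr lborel borel T) A * indicator ?B x \<partial>lborel)"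
  proof (rule nn_integral_cong)
    fix x
    obtain c where c: "\<And>y. T y + x = T (y + c)" using ptrans[of x] by blast
    have "(\<integral>\<^sup>+y. indicator A (x + T y) \<partial>lborel) = (\<integral>\<^sup>+y. indicator A (T (y + c)) \<partial>lborel)"
      by (simp add: c[symmetric] add.commute)
    also have "\<dots> = (\<integral>\<^sup>+y. indicator A (T y) \<partial>lborel)"
      by (rule trans) measurable
    also have "\<dots> = (\<integral>\<^sup>+y. indicator A y \<partial>distr lborel borel T)"
      by (subst nn_integral_distr) auto
    also have "\<dots> = emeasure (distr lborel borel T) A"
      by (rule nn_integral_indicator) simp
    finally have "(\<integral>\<^sup>+y. indicator A (x + T y) \<partial>lborel) = emeasure (distr lborel borel T) A"
      .
    moreover have "(\<lambda>y. indicator A (x + T y) :: ennreal) \<in> borel_measurable lborel" by measurable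
    ultimately show "(\<integral>\<^sup>+y. indicator A (x + T y) * indicator ?B x \<partial>lborel)
        = emeasure (distr lborel borel T) A * indicator ?B x"
      by (simp add: nn_integral_multc)
  qed
  also have "\<dots> = emeasure (distr lborel borel T) A * emeasure lborel ?B"
    by (subst nn_integral_cmult) auto
  finally have "emeasure lborel ?B * emeasure (distr lborel borel T) A = emeasure lborel ?B * emeasure lborel A"
    by (simp add: mult.commute)
  moreover have "emeasure lborel ?B \<noteq> 0" "emeasure lborel ?B \<noteq> \<infinity>"
    using unit_ball_vol_pos[of "real DIM('a)"] by (auto simp: emeasure_ball simp del: unit_ball_vol_pos)
  ultimately show "emeasure (distr lborel borel T) A = emeasure lborel A"
    by (simp add: ennreal_mult_cancel_left)
qed simp

text \<open>Lebesgue measure is determined by its values on boxes. A box pulls back to a product of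
  boxes, and \<open>Basis\<close> is indexed by pairs of a coordinate and a basis vector of the
  entry space, so the side lengths multiply to the same number.\<close>

lemma lborel_vec_eq_distr_PiM:
  "distr (Pi\<^sub>M UNIV (\<lambda>_. lborel)) borel vec_lambda = (lborel :: ('a::euclidean_space ^ 'n) measure)"
proof (rule sym, rule lborel_eqI)
  fix l u :: "'a ^ 'n"
  assume le: "\<And>b. b \<in> Basis \<Longrightarrow> l \<bullet> b \<le> u \<bullet> b"
  interpret finite_product_sigma_finite "\<lambda>_::'n. lborel :: 'a measure" UNIV
    by standard auto
  have [measurable]: "vec_lambda \<in> measurable (Pi\<^sub>M UNIV (\<lambda>_. lborel)) (borel :: ('a ^ 'n) measure)"
    by (intro borel_measurable_vecI) simp
  have eq: "vec_lambda -` box l u \<inter> space (Pi\<^sub>M UNIV (\<lambda>_. lborel)) = (\<Pi>\<^sub>E i\<in>UNIV. box (l $ i) (u $ i))"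
    by (auto simp: space_PiM box_def Basis_vec_def inner_axis)
  have le': "l $ i \<bullet> b \<le> u $ i \<bullet> b" if "b \<in> Basis" for i b
    using le[of "axis i b"] that by (simp add: inner_axis)
  have bij: "bij_betw (\<lambda>(i, b). axis i b) (UNIV \<times> Basis) (Basis :: ('a ^ 'n) set)"
    by (auto simp: bij_betw_def inj_on_def axis_eq_axis Basis_vec_def image_iff)
  have "emeasure (distr (Pi\<^sub>M UNIV (\<lambda>_. lborel)) borel vec_lambda) (box l u)
      = (\<Prod>i\<in>UNIV. emeasure lborel (box (l $ i) (u $ i)))"
    by (simp add: emeasure_distr eq measure_times)
  also have "\<dots> = (\<Prod>i\<in>UNIV. ennreal (\<Prod>b\<in>Basis. (u $ i - l $ i) \<bullet> b))"
    using le' by (intro prod.cong refl) (simp add: emeasure_lborel_box)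
  also have "\<dots> = ennreal (\<Prod>i\<in>UNIV. \<Prod>b\<in>Basis. (u $ i - l $ i) \<bullet> b)"
    using le' by (intro prod_ennreal prod_nonneg) (auto simp: inner_diff_left)
  also have "(\<Prod>i\<in>UNIV. \<Prod>b\<in>Basis. (u $ i - l $ i) \<bullet> b) = (\<Prod>b\<in>Basis. (u - l) \<bullet> b)"
    by (subst prod.cartesian_product, subst prod.reindex_bij_betw[OF bij, symmetric])
       (auto simp: inner_axis intro!: prod.cong)
  finally show "emeasure (distr (Pi\<^sub>M UNIV (\<lambda>_. lborel)) borel vec_lambda) (box l u)
      = (\<Prod>b\<in>Basis. (u - l) \<bullet> b)" .
qed simp

text \<open>A product measure is determined by rectangles, on which the indicator factors over the
  coordinates and the integral of a product splits.\<close>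

lemma density_PiM:
  assumes I: "finite I"
    and sf: "\<And>i. sigma_finite_measure (M i)"
    and sfd: "\<And>i. sigma_finite_measure (density (M i) (f i))"
    and [measurable]: "\<And>i. f i \<in> borel_measurable (M i)"
  shows "density (Pi\<^sub>M I M) (\<lambda>x. \<Prod>i\<in>I. f i (x i)) = Pi\<^sub>M I (\<lambda>i. density (M i) (f i))"
proof -
  interpret M: product_sigma_finite M by (simp add: product_sigma_finite_def sf)
  interpret D: product_sigma_finite "\<lambda>i. density (M i) (f i)"
    by (simp add: product_sigma_finite_def sfd)
  show ?thesis
  proof (rule D.PiM_eqI[OF I])
    show "sets (density (Pi\<^sub>M I M) (\<lambda>x. \<Prod>i\<in>I. f i (x i))) = sets (Pi\<^sub>M I (\<lambda>i. density (M i) (f i)))"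
      by (simp cong: sets_PiM_cong)
  next
    fix A assume "\<And>i. i \<in> I \<Longrightarrow> A i \<in> sets (density (M i) (f i))"
    then have A [measurable]: "\<And>i. i \<in> I \<Longrightarrow> A i \<in> sets (M i)" by simp
    have PA: "Pi\<^sub>E I A \<in> sets (Pi\<^sub>M I M)" using A I by (intro sets_PiM_I_finite) auto
    have "emeasure (density (Pi\<^sub>M I M) (\<lambda>x. \<Prod>i\<in>I. f i (x i))) (Pi\<^sub>E I A)
        = (\<integral>\<^sup>+x. (\<Prod>i\<in>I. f i (x i)) * indicator (Pi\<^sub>E I A) x \<partial>Pi\<^sub>M I M)"
      using PA by (subst emeasure_density) auto
    also have "\<dots> = (\<integral>\<^sup>+x. (\<Prod>i\<in>I. f i (x i) * indicator (A i) (x i)) \<partial>Pi\<^sub>M I M)"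
    proof (rule nn_integral_cong)
      fix x assume x: "x \<in> space (Pi\<^sub>M I M)"
      have "indicator (Pi\<^sub>E I A) x = (\<Prod>i\<in>I. indicator (A i) (x i) :: ennreal)"
      proof (cases "x \<in> Pi\<^sub>E I A")
        case True
        then have "(\<Prod>i\<in>I. indicator (A i) (x i) :: ennreal) = 1"
          by (intro prod.neutral) (auto simp: PiE_iff)
        with True show ?thesis by simp
      next
        case False
        then obtain i where "i \<in> I" "x i \<notin> A i"
          using x by (auto simp: space_PiM PiE_iff)
        then have "(\<Prod>i\<in>I. indicator (A i) (x i) :: ennreal) = 0"
          using I by (intro prod_zero) (auto simp: indicator_def)
        with False show ?thesis by simp
      qed
      then show "(\<Prod>i\<in>I. f i (x i)) * indicator (Pi\<^sub>E I A) x = (\<Prod>i\<in>I. f i (x i) * indicator (A i) (x i))"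
        by (simp add: prod.distrib)
    qed
    also have "\<dots> = (\<Prod>i\<in>I. \<integral>\<^sup>+y. f i y * indicator (A i) y \<partial>M i)"
      by (rule M.product_nn_integral_prod[OF I]) auto
    also have "\<dots> = (\<Prod>i\<in>I. emeasure (density (M i) (f i)) (A i))"
      by (intro prod.cong refl) (simp add: emeasure_density)
    finally show "emeasure (density (Pi\<^sub>M I M) (\<lambda>x. \<Prod>i\<in>I. f i (x i))) (Pi\<^sub>E I A)
        = (\<Prod>i\<in>I. emeasure (density (M i) (f i)) (A i))" .
  qed
qed

text \<open>The disc of radius sqrt t has area pi t, so the squared modulus pushes planar Lebesgue
  measure to pi times Lebesgue measure on the half-line.\<close>

lemma nn_integral_norm_sq_complex:
  fixes h :: "real \<Rightarrow> ennreal"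
  assumes [measurable]: "h \<in> borel_measurable borel"
  shows "(\<integral>\<^sup>+z. h ((norm (z::complex))\<^sup>2) \<partial>lborel) = (\<integral>\<^sup>+t. ennreal pi * h t * indicator {0..} t \<partial>lborel)"
proof -
  \<comment> \<open>The sign is flipped because \<open>measure_eqI_lessThan\<close> compares upper
    tails and needs them finite; those of the squared modulus itself are infinite.\<close>
  have tail: "emeasure (distr lborel borel (\<lambda>z::complex. - (norm z)\<^sup>2)) {x<..}
      = ennreal (if x < 0 then pi * (- x) else 0)" for x
  proof -
    have "emeasure (distr lborel borel (\<lambda>z::complex. - (norm z)\<^sup>2)) {x<..}
      = emeasure lborel {z::complex. x < - (norm z)\<^sup>2}"
      by (subst emeasure_distr) (auto intro!: arg_cong[of _ _ "emeasure lborel"])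
    also have "{z::complex. x < - (norm z)\<^sup>2} = (if x < 0 then ball 0 (sqrt (- x)) else {})"
    proof -
      have "norm z < sqrt (- x) \<longleftrightarrow> (norm z)\<^sup>2 < - x" for z :: complex
        using real_less_rsqrt[of "norm z" "-x"] real_sqrt_less_iff[of "(norm z)\<^sup>2" "-x"] by auto
      moreover have "\<not> x < - (norm z)\<^sup>2" if "\<not> x < 0" for z :: complex
        using that zero_le_power2[of "norm z"] by linarith
      ultimately show ?thesis by auto
    qed
    also have "emeasure lborel \<dots> = ennreal (if x < 0 then pi * (- x) else 0)"
      using unit_ball_vol_even[of 1] by (simp add: emeasure_ball)
    finally show ?thesis .
  qed
  have dens: "distr lborel borel (\<lambda>z::complex. - (norm z)\<^sup>2)
      = density lborel (\<lambda>u. ennreal pi * indicator {..0} u)"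
  proof (rule measure_eqI_lessThan)
    fix x :: real
    have "emeasure (density lborel (\<lambda>u. ennreal pi * indicator {..0} u)) {x<..}
        = (\<integral>\<^sup>+u. ennreal pi * indicator {x<..0} u \<partial>lborel)"
      by (subst emeasure_density) (auto intro!: nn_integral_cong split: split_indicator)
    also have "\<dots> = ennreal (if x < 0 then pi * (- x) else 0)"
      by (subst nn_integral_cmult) (auto simp flip: ennreal_mult')
    finally show "emeasure (distr lborel borel (\<lambda>z::complex. - (norm z)\<^sup>2)) {x<..}
        = emeasure (density lborel (\<lambda>u. ennreal pi * indicator {..0} u)) {x<..}"
      by (simp add: tail)
  qed (simp_all add: tail)
  have "(\<integral>\<^sup>+z. h ((norm (z::complex))\<^sup>2) \<partial>lborel)
      = (\<integral>\<^sup>+u. h (- u) \<partial>distr lborel borel (\<lambda>z::complex. - (norm z)\<^sup>2))"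
    by (simp add: nn_integral_distr)
  also have "\<dots> = (\<integral>\<^sup>+u. ennreal pi * indicator {..0} u * h (- u) \<partial>lborel)"
    unfolding dens by (simp add: nn_integral_density)
  also have "\<dots> = (\<integral>\<^sup>+u. ennreal pi * indicator {..0} u * h (- u) \<partial>distr lborel borel uminus)"
    by (simp only: lborel_distr_uminus)
  also have "\<dots> = (\<integral>\<^sup>+t. ennreal pi * indicator {..0} (- t) * h (- (- t)) \<partial>lborel)"
    by (rule nn_integral_distr) auto
  also have "\<dots> = (\<integral>\<^sup>+t. ennreal pi * h t * indicator {0..} t \<partial>lborel)"
    by (intro nn_integral_cong) (auto split: split_indicator)
  finally show ?thesis .
qed

subsection \<open>Complex Gaussian vectors\<close>

text \<open>The variance is chosen such that the squared modulus is exponential with parameter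
  1.\<close>

definition gauss1 :: "complex measure" where
  "gauss1 = density lborel (\<lambda>z. ennreal (exp (- (norm z)\<^sup>2) / pi))"

lemma sets_gauss1 [measurable_cong, simp]: "sets gauss1 = sets borel"
  and space_gauss1 [simp]: "space gauss1 = UNIV"
  by (simp_all add: gauss1_def)

lemma nn_integral_gauss1_norm_sq:
  fixes h :: "real \<Rightarrow> ennreal"
  assumes [measurable]: "h \<in> borel_measurable borel"
  shows "(\<integral>\<^sup>+z. h ((norm z)\<^sup>2) \<partial>gauss1) = (\<integral>\<^sup>+t. ennreal (exp (- t)) * h t * indicator {0..} t \<partial>lborel)"
proof -
  have "(\<integral>\<^sup>+z. h ((norm z)\<^sup>2) \<partial>gauss1)
      = (\<integral>\<^sup>+z. ennreal (exp (- (norm (z::complex))\<^sup>2) / pi) * h ((norm z)\<^sup>2) \<partial>lborel)"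
    unfolding gauss1_def by (simp add: nn_integral_density)
  also have "\<dots> = (\<integral>\<^sup>+t. ennreal pi * (ennreal (exp (- t) / pi) * h t) * indicator {0..} t \<partial>lborel)"
    by (rule nn_integral_norm_sq_complex) measurable
  also have "\<dots> = (\<integral>\<^sup>+t. ennreal (exp (- t)) * h t * indicator {0..} t \<partial>lborel)"
    by (simp add: mult.assoc[symmetric] flip: ennreal_mult')
  finally show ?thesis .
qed

text \<open>Laplace transform of the exponential law; s = 0 gives the total mass.\<close>

lemma gauss1_laplace:
  assumes "s \<ge> 0"
  shows "(\<integral>\<^sup>+z. ennreal (exp (- s * (norm z)\<^sup>2)) \<partial>gauss1) = ennreal (1 / (1 + s))"
proof -
  have "(\<integral>\<^sup>+z. ennreal (exp (- s * (norm z)\<^sup>2)) \<partial>gauss1)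
      = (\<integral>\<^sup>+t. ennreal (exp (- ((1 + s) * t))) * indicator {0..} t \<partial>lborel)"
    by (subst nn_integral_gauss1_norm_sq[where h = "\<lambda>t. ennreal (exp (- s * t))"])
       (auto simp: algebra_simps simp flip: ennreal_mult' exp_add)
  also have "\<dots> = ennreal (0 - (- (exp (- ((1 + s) * 0)) / (1 + s))))"
  proof (rule nn_integral_FTC_atLeast)
    show "((\<lambda>t. - (exp (- ((1 + s) * t)) / (1 + s))) \<longlongrightarrow> 0) at_top"
      using assms by real_asymp
    have eq: "- (exp (- ((1 + s) * x)) * (- 1 - s) / (1 + s)) = exp (- ((1 + s) * x))" for x
    proof -
      have "- 1 - s = - (1 + s)" by simp
      with assms show ?thesis by (simp only: mult_minus_right) simp
    qed
    show "DERIV (\<lambda>t. - (exp (- ((1 + s) * t)) / (1 + s))) x :> exp (- ((1 + s) * x))" for x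
      using assms by (auto intro!: derivative_eq_intros simp: eq)
  qed auto
  finally show ?thesis by simp
qed

lemma prob_space_gauss1: "prob_space gauss1"
proof
  show "emeasure gauss1 (space gauss1) = 1"
    using gauss1_laplace[of 0] by simp
qed

lemma gauss1_tail:
  assumes "c \<ge> 0"
  shows "emeasure gauss1 {z. c < (norm z)\<^sup>2} = ennreal (exp (- c))"
proof -
  have "emeasure gauss1 {z. c < (norm z)\<^sup>2} = (\<integral>\<^sup>+z. indicator {c<..} ((norm z)\<^sup>2) \<partial>gauss1)"
    using nn_integral_indicator[of "{z. c < (norm z)\<^sup>2}" gauss1] by (simp add: indicator_def)
  \<comment> \<open>As c \<ge> 0, the restriction to the half-line is implied; adding the end point
    c changes a null set only.\<close>
  also have "\<dots> = (\<integral>\<^sup>+t. ennreal (exp (- t)) * indicator {c..} t \<partial>lborel)"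
    unfolding nn_integral_gauss1_norm_sq[OF borel_measurable_indicator[OF greaterThan_borel]]
    using AE_lborel_singleton[of c] assms
    by (intro nn_integral_cong_AE) (auto split: split_indicator elim!: eventually_mono)
  also have "\<dots> = ennreal (0 - (- exp (- c)))"
  proof (rule nn_integral_FTC_atLeast)
    show "((\<lambda>t::real. - exp (- t)) \<longlongrightarrow> 0) at_top"
      by real_asymp
    show "DERIV (\<lambda>t. - exp (- t)) x :> exp (- x)" for x :: real
      by (auto intro!: derivative_eq_intros)
  qed auto
  finally show ?thesis by simp
qed

definition gauss :: "(complex ^ 'n) measure" where
  "gauss = distr (Pi\<^sub>M UNIV (\<lambda>_. gauss1)) borel vec_lambda"

lemma sets_gauss [measurable_cong, simp]: "sets gauss = sets borel"
  and space_gauss [simp]: "space gauss = UNIV"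
  by (simp_all add: gauss_def)

lemma measurable_vec_lambda_gauss1 [measurable]:
  "vec_lambda \<in> measurable (Pi\<^sub>M UNIV (\<lambda>_. gauss1)) (borel :: (complex ^ 'n) measure)"
  by (intro borel_measurable_vecI) simp

lemma product_prob_space_gauss1: "product_prob_space (\<lambda>_. gauss1)"
  by (simp add: product_prob_space_def product_prob_space_axioms_def product_sigma_finite_def
      prob_space_gauss1 prob_space_imp_sigma_finite)

lemma prob_space_gauss: "prob_space gauss"
proof -
  have "prob_space (Pi\<^sub>M UNIV (\<lambda>_::'n. gauss1))"
    by (intro prob_space_PiM prob_space_gauss1)
  then show ?thesis
    unfolding gauss_def by (rule prob_space.prob_space_distr) measurable
qed

text \<open>The product of the one-dimensional densities depends on the norm alone, which yields
  unitary invariance. The defining product form is kept for the independence of the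
  coordinates.\<close>

lemma gauss_eq_density:
  "(gauss :: (complex ^ 'n) measure) = density lborel (\<lambda>x. ennreal (exp (- (norm x)\<^sup>2) / pi ^ CARD('n)))"
proof -
  have prod: "(\<Prod>i\<in>UNIV. ennreal (exp (- (norm (f i))\<^sup>2) / pi))
      = ennreal (exp (- (norm (vec_lambda f :: complex ^ 'n))\<^sup>2) / pi ^ CARD('n))" for f
    by (subst prod_ennreal)
       (auto simp: norm_vec_sq_real prod_dividef simp flip: exp_sum sum_negf)
  have "(Pi\<^sub>M UNIV (\<lambda>_. gauss1) :: ('n \<Rightarrow> complex) measure)
      = density (Pi\<^sub>M UNIV (\<lambda>_. lborel))
          (\<lambda>x. \<Prod>i\<in>UNIV. ennreal (exp (- (norm (x i))\<^sup>2) / pi))"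
    unfolding gauss1_def
    by (rule density_PiM[symmetric])
       (auto simp: lborel.sigma_finite_measure_axioms
          prob_space_imp_sigma_finite[OF prob_space_gauss1, unfolded gauss1_def])
  then have "(gauss :: (complex ^ 'n) measure)
      = distr (density (Pi\<^sub>M UNIV (\<lambda>_. lborel))
          (\<lambda>x. ennreal (exp (- (norm (vec_lambda x :: complex ^ 'n))\<^sup>2) / pi ^ CARD('n)))) borel vec_lambda"
    by (simp add: gauss_def prod)
  also have "\<dots> = density (distr (Pi\<^sub>M UNIV (\<lambda>_. lborel)) borel vec_lambda)
       (\<lambda>x. ennreal (exp (- (norm x)\<^sup>2) / pi ^ CARD('n)))"
    by (rule density_distr[symmetric]) (auto intro!: borel_measurable_vecI)
  finally show ?thesis by (simp only: lborel_vec_eq_distr_PiM)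
qed

lemma unitary_orthogonal_transformation:
  assumes "U \<in> unitary_group"
  shows "orthogonal_transformation ((*v) U)"
  unfolding orthogonal_transformation
proof
  show "linear ((*v) U)"
    by (rule linearI)
      (simp_all add: vec_eq_iff matrix_vector_mult_def scaleR_sum_right sum.distrib distrib_left)
qed (use unitary_norm[OF assms] in blast)

lemma measurable_matrix_vector_mult [measurable]:
  "(\<lambda>x. A *v x) \<in> borel_measurable (borel :: (complex ^ 'n) measure)"
  by (intro borel_measurable_vecI) (simp add: matrix_vector_mult_def)

lemma gauss_unitary_invariant:
  fixes U :: "complex ^ 'n ^ 'n"
  assumes "U \<in> unitary_group"
  shows "distr gauss borel ((*v) U) = gauss"
proof -
  \<comment> \<open>Written as a function of \<open>U *v x\<close>, the density can be taken out of
    the push-forward; its value is the same because \<open>U\<close> preserves the norm.\<close>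
  have "distr (density lborel (\<lambda>x. ennreal (exp (- (norm (U *v x))\<^sup>2) / pi ^ CARD('n)))) borel ((*v) U)
      = density (distr lborel borel ((*v) U)) (\<lambda>x. ennreal (exp (- (norm x)\<^sup>2) / pi ^ CARD('n)))"
    by (rule density_distr[symmetric]) measurable
  then show ?thesis
    by (simp add: gauss_eq_density unitary_norm[OF assms]
        lborel_distr_orthogonal[OF unitary_orthogonal_transformation[OF assms]])
qed

text \<open>The squared moduli of the coordinates are independent exponential variables: the tail of
  one of them, evaluated at a multiple of the sum of the others, is a product of Laplace
  transforms.\<close>
lemma gauss_ratio_tail:
  fixes i :: "'n::finite"
  assumes s: "s \<ge> 0" and iS: "i \<notin> S"
  shows "emeasure gauss {g. s * (\<Sum>j\<in>S. (norm (g $ j))\<^sup>2) < (norm (g $ i))\<^sup>2} = ennreal ((1 / (1 + s)) ^ card S)"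
proof -
  interpret product_prob_space "\<lambda>_. gauss1" "UNIV :: 'n set" by (rule product_prob_space_gauss1)
  let ?E = "\<lambda>f. s * (\<Sum>j\<in>S. (norm (f j :: complex))\<^sup>2) < (norm (f i))\<^sup>2"
  have "emeasure gauss {g. s * (\<Sum>j\<in>S. (norm (g $ j))\<^sup>2) < (norm (g $ i))\<^sup>2}
      = emeasure (Pi\<^sub>M UNIV (\<lambda>_. gauss1)) {f \<in> space (Pi\<^sub>M UNIV (\<lambda>_. gauss1)). ?E f}"
    unfolding gauss_def by (subst emeasure_distr) (auto intro!: arg_cong[of _ _ "emeasure _"])
  also have "\<dots> = (\<integral>\<^sup>+f. indicator {f. ?E f} f \<partial>Pi\<^sub>M (insert i (UNIV - {i})) (\<lambda>_. gauss1))"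
  proof -
    have "{f \<in> space (Pi\<^sub>M UNIV (\<lambda>_. gauss1)). ?E f} \<in> sets (Pi\<^sub>M UNIV (\<lambda>_::'n. gauss1))"
      by measurable
    from nn_integral_indicator[OF this] show ?thesis
      by (simp add: insert_absorb space_PiM)
  qed
  \<comment> \<open>Coordinate i is integrated first with the others frozen, so that
    \<open>gauss1_tail\<close> applies to a constant threshold.\<close>
  also have "\<dots> = (\<integral>\<^sup>+x. (\<integral>\<^sup>+y. indicator {f. ?E f} (x(i := y)) \<partial>gauss1) \<partial>Pi\<^sub>M (UNIV - {i}) (\<lambda>_. gauss1))"
  proof (rule product_nn_integral_insert)
    have "{f \<in> space (Pi\<^sub>M UNIV (\<lambda>_. gauss1)). ?E f} \<in> sets (Pi\<^sub>M UNIV (\<lambda>_::'n. gauss1))"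
      by measurable
    then show "indicator {f. ?E f} \<in> borel_measurable (Pi\<^sub>M (insert i (UNIV - {i})) (\<lambda>_. gauss1))"
      by (simp add: insert_absorb space_PiM)
  qed auto
  \<comment> \<open>The exponential of the sum becomes a product, padded with factors 1 to run over
    all remaining coordinates.\<close>
  also have "\<dots> = (\<integral>\<^sup>+x. (\<Prod>j\<in>UNIV - {i}. if j \<in> S then ennreal (exp (- s * (norm (x j))\<^sup>2)) else 1) \<partial>Pi\<^sub>M (UNIV - {i}) (\<lambda>_. gauss1))"
  proof (rule nn_integral_cong)
    fix x :: "'n \<Rightarrow> complex"
    have "(\<Sum>j\<in>S. (norm ((x(i := y)) j))\<^sup>2) = (\<Sum>j\<in>S. (norm (x j))\<^sup>2)" for y
      using iS by (intro sum.cong) auto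
    then have "(\<integral>\<^sup>+y. indicator {f. ?E f} (x(i := y)) \<partial>gauss1)
       = (\<integral>\<^sup>+y. indicator {z. s * (\<Sum>j\<in>S. (norm (x j))\<^sup>2) < (norm z)\<^sup>2} y \<partial>gauss1)"
      by (intro nn_integral_cong) (auto simp: indicator_def)
    also have "\<dots> = ennreal (exp (- (s * (\<Sum>j\<in>S. (norm (x j))\<^sup>2))))"
      using s by (subst nn_integral_indicator) (auto simp: gauss1_tail sum_nonneg)
    also have "\<dots> = (\<Prod>j\<in>S. ennreal (exp (- s * (norm (x j))\<^sup>2)))"
      by (subst prod_ennreal) (auto simp: sum_distrib_left simp flip: exp_sum sum_negf)
    also have "\<dots> = (\<Prod>j\<in>UNIV - {i}. if j \<in> S then ennreal (exp (- s * (norm (x j))\<^sup>2)) else 1)"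
      using iS by (intro prod.mono_neutral_cong_left) auto
    finally show "(\<integral>\<^sup>+y. indicator {f. ?E f} (x(i := y)) \<partial>gauss1) = \<dots>" .
  qed
  also have "\<dots> = (\<Prod>j\<in>UNIV - {i}. \<integral>\<^sup>+z. (if j \<in> S then ennreal (exp (- s * (norm z)\<^sup>2)) else 1) \<partial>gauss1)"
    by (rule product_nn_integral_prod[where f = "\<lambda>j z. if j \<in> S then ennreal (exp (- s * (norm z)\<^sup>2)) else 1"]) auto
  also have "\<dots> = (\<Prod>j\<in>UNIV - {i}. if j \<in> S then ennreal (1 / (1 + s)) else 1)"
    using gauss1_laplace[OF s] prob_space.emeasure_space_1[OF prob_space_gauss1]
    by (intro prod.cong) auto
  also have "\<dots> = (\<Prod>j\<in>S. ennreal (1 / (1 + s)))"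
    using iS by (intro prod.mono_neutral_cong_right) auto
  also have "\<dots> = ennreal ((1 / (1 + s)) ^ card S)"
    using s by (simp add: ennreal_power)
  finally show ?thesis .
qed

text \<open>For empty \<open>S\<close> the tail formula has exponent 0 and gives probability 1. This
  excludes the default value of \<open>normalise\<close>.\<close>

lemma AE_gauss_nth_neq_0: "AE g in gauss. g $ i \<noteq> 0"
proof -
  interpret prob_space "gauss :: (complex ^ 'n) measure" by (rule prob_space_gauss)
  have "emeasure gauss {g. g $ i \<noteq> 0} = 1"
    using gauss_ratio_tail[of 0 i "{}"] by simp
  then show ?thesis
    using emeasure_space_1 by (intro AE_I_eq_1) auto
qed

subsection \<open>Coordinates of a uniform point of the sphere\<close>

lemma sets_beta1_law [measurable_cong, simp]: "sets (beta1_law k) = sets borel"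
  by (simp add: beta1_law_def beta_measure_def)

text \<open>For k > 0 the density is k (1 - u)^(k - 1) with antiderivative -(1 - u)^k. The formula
  also covers the Dirac law at 1, since (1 - t)^0 = 1 for t < 1.\<close>

lemma beta1_law_tail:
  "emeasure (beta1_law k) {t<..} = ennreal (if t < 0 then 1 else if t < 1 then (1 - t) ^ k else 0)"
proof (cases "k = 0")
  case True
  then show ?thesis by (simp add: beta1_law_def indicator_def)
next
  case False
  have "Gamma (1 + real k) = real k * Gamma (real k)"
    using False by (subst add.commute, intro Gamma_plus1) (auto elim!: nonpos_Ints_cases)
  moreover have "Gamma (real k) \<noteq> 0"
    using False by (intro Gamma_real_pos[THEN less_imp_neq, symmetric]) simp
  ultimately have c: "Gamma (1 + real k) / (Gamma 1 * Gamma (real k)) = real k"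
    by simp
  have powr: "(1 - u) powr (real k - 1) = (1 - u) ^ (k - 1)" if "u < 1" for u :: real
    using that False by (simp add: powr_realpow[symmetric])
  have "emeasure (beta1_law k) {t<..} = (\<integral>\<^sup>+u. ennreal (beta_density 1 (real k) u) * indicator {t<..} u \<partial>lborel)"
    using False by (simp add: beta1_law_def beta_measure_def beta_density_def emeasure_density)
  \<comment> \<open>\<open>powr\<close> and the power can differ at 0 and 1, where
    \<open>0 powr 0 = 0\<close>, and the interval is closed at t for the fundamental theorem; these
    points are null.\<close>
  also have "\<dots> = (\<integral>\<^sup>+u. ennreal (real k * (1 - u) ^ (k - 1)) * indicator {max 0 t..1} u \<partial>lborel)"
  proof (rule nn_integral_cong_AE)
    show "AE u in lborel. ennreal (beta_density 1 (real k) u) * indicator {t<..} u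
        = ennreal (real k * (1 - u) ^ (k - 1)) * indicator {max 0 t..1} u"
      using AE_lborel_singleton[of 0] AE_lborel_singleton[of 1] AE_lborel_singleton[of t]
    proof eventually_elim
      case (elim u)
      then show ?case
        unfolding beta_density_def c by (auto simp: powr indicator_def)
    qed
  qed
  also have "\<dots> = ennreal (if t < 0 then 1 else if t < 1 then (1 - t) ^ k else 0)"
  proof (cases "t < 1")
    case True
    have "(\<integral>\<^sup>+u. ennreal (real k * (1 - u) ^ (k - 1)) * indicator {max 0 t..1} u \<partial>lborel)
        = ennreal (- ((1 - 1) ^ k) - - ((1 - max 0 t) ^ k))"
    proof (rule nn_integral_FTC_Icc)
      show "DERIV (\<lambda>u. - ((1 - u) ^ k)) u :> real k * (1 - u) ^ (k - 1)" for u :: real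
        by (auto intro!: derivative_eq_intros)
    qed (use True in auto)
    with True False show ?thesis by (simp add: max_def power_0_left)
  next
    case F: False
    have "(\<integral>\<^sup>+u. ennreal (real k * (1 - u) ^ (k - 1)) * indicator {max 0 t..1} u \<partial>lborel) = (\<integral>\<^sup>+(u::real). 0 \<partial>lborel)"
      using AE_lborel_singleton[of 1] F
      by (intro nn_integral_cong_AE) (auto simp: indicator_def elim!: eventually_mono)
    with F show ?thesis by simp
  qed
  finally show ?thesis .
qed

text \<open>Identification by tails treats the Dirac case and the densities in one argument.\<close>

lemma real_measure_eq_beta1_law:
  assumes "sets M = sets borel"
    and "\<And>t. emeasure M {t<..} = ennreal (if t < 0 then 1 else if t < 1 then (1 - t) ^ k else 0)"
  shows "M = beta1_law k"
  using assms by (intro measure_eqI_lessThan) (simp_all add: beta1_law_tail)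

lemma prob_space_beta1_law: "prob_space (beta1_law k)"
proof (cases "k = 0")
  case True
  then show ?thesis by (auto simp: beta1_law_def intro: prob_space_return)
next
  case False
  have "emeasure (beta1_law k) (space (beta1_law k)) = emeasure (beta1_law k) (\<Union>n. {- real (Suc n)<..})"
  proof -
    have "(\<Union>n. {- real (Suc n)<..}) = UNIV"
    proof safe
      fix x :: real
      obtain n where "- x < real n" using reals_Archimedean2 by blast
      then show "x \<in> (\<Union>n. {- real (Suc n)<..})" by (auto intro!: exI[of _ n])
    qed simp
    moreover have "space (beta1_law k) = UNIV" using sets_eq_imp_space_eq[OF sets_beta1_law] by simp
    ultimately show ?thesis by simp
  qed
  moreover have "\<dots> = (SUP n. emeasure (beta1_law k) {- real (Suc n)<..})"
    by (rule SUP_emeasure_incseq[symmetric]) (auto simp: incseq_def)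
  moreover have "\<dots> = 1" by (simp add: beta1_law_tail)
  ultimately show ?thesis by (intro prob_spaceI) simp
qed

definition sphere_point :: "'n \<Rightarrow> 'n set \<Rightarrow> complex ^ 'n \<Rightarrow> complex ^ 'n" where
  "sphere_point i S g = normalise i (coord_proj S g)"

lemma norm_sphere_point [simp]: "norm (sphere_point i S g) = 1"
  by (simp add: sphere_point_def)

lemma sphere_point_support: "i \<in> S \<Longrightarrow> j \<notin> S \<Longrightarrow> sphere_point i S g $ j = 0"
  by (auto simp: sphere_point_def normalise_def coord_proj_def axis_def)

lemma sphere_point_unitary:
  assumes "U \<in> fix_unitary S" "i \<in> S" "g $ i \<noteq> 0"
  shows "sphere_point i S (U *v g) = U *v sphere_point i S g"
proof -
  have "coord_proj S g \<noteq> 0"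
    using assms(2,3) by (auto simp: coord_proj_def vec_eq_iff intro!: exI[of _ i])
  then show ?thesis
    using assms(1) by (simp add: sphere_point_def coord_proj_fix_unitary normalise_unitary fix_unitary_unitary)
qed

lemma measurable_sphere_point [measurable]: "sphere_point i S \<in> borel_measurable borel"
proof -
  have [measurable]: "coord_proj S \<in> borel_measurable borel"
    by (rule borel_measurable_vecI) (simp add: coord_proj_def)
  have [measurable]: "normalise i \<in> borel_measurable borel"
    unfolding normalise_def by measurable
  show ?thesis unfolding sphere_point_def by measurable
qed

text \<open>Almost surely the squared modulus is a / (a + b), with a the squared modulus of g_i and
  b the sum of the others over \<open>S\<close>; its tails are those of the ratio in
  \<open>gauss_ratio_tail\<close>.\<close>

lemma sphere_point_sq_law:
  assumes iS: "i \<notin> S"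
  shows "distr gauss borel (\<lambda>g. (norm (sphere_point i (insert i S) g $ i))\<^sup>2) = beta1_law (card S)"
proof (rule real_measure_eq_beta1_law)
  fix t :: real
  interpret prob_space "gauss :: (complex ^ 'n) measure" by (rule prob_space_gauss)
  let ?X = "\<lambda>g. (norm (sphere_point i (insert i S) g $ i))\<^sup>2"
  have X: "AE g in gauss. ?X g = (norm (g $ i))\<^sup>2 / ((norm (g $ i))\<^sup>2 + (\<Sum>j\<in>S. (norm (g $ j))\<^sup>2))"
    using AE_gauss_nth_neq_0[of i]
  proof eventually_elim
    case (elim g)
    let ?p = "coord_proj (insert i S) g"
    have "(norm ?p)\<^sup>2 = (\<Sum>j\<in>insert i S. (norm (g $ j))\<^sup>2)"
      unfolding norm_vec_sq_real by (rule sum.mono_neutral_cong_right) (auto simp: coord_proj_def)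
    also have "\<dots> = (norm (g $ i))\<^sup>2 + (\<Sum>j\<in>S. (norm (g $ j))\<^sup>2)"
      using iS by simp
    finally have n: "(norm ?p)\<^sup>2 = (norm (g $ i))\<^sup>2 + (\<Sum>j\<in>S. (norm (g $ j))\<^sup>2)" .
    have "?p $ i = g $ i" by (simp add: coord_proj_def)
    with elim have "?p \<noteq> 0" by (metis zero_index)
    with \<open>?p $ i = g $ i\<close> show ?case
      by (simp add: sphere_point_def normalise_def power_mult_distrib power_divide n)
  qed
  have meas [measurable]: "?X \<in> borel_measurable gauss" by measurable
  have "emeasure (distr gauss borel ?X) {t<..} = emeasure gauss {g \<in> space gauss. t < ?X g}"
    by (subst emeasure_distr) (auto intro!: arg_cong[of _ _ "emeasure _"])
  also have "\<dots> = ennreal (if t < 0 then 1 else if t < 1 then (1 - t) ^ card S else 0)"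
  proof -
    consider "t < 0" | "0 \<le> t" "t < 1" | "1 \<le> t" by linarith
    then show ?thesis
    proof cases
      case 1
      then have "t < ?X g" for g by (meson less_le_trans zero_le_power2)
      then have "{g \<in> space gauss. t < ?X g} = space gauss" by auto
      with 1 show ?thesis by (simp add: emeasure_space_1[simplified])
    next
      case 2
      \<comment> \<open>Solving t < a / (a + b) for a gives s b < a, and 1 / (1 + s) = 1 - t turns
        the ratio tail into the beta tail.\<close>
      define s where "s = t / (1 - t)"
      have s: "s \<ge> 0" "1 / (1 + s) = 1 - t" using 2 by (auto simp: s_def field_simps)
      have "emeasure gauss {g \<in> space gauss. t < ?X g}
          = emeasure gauss {g. s * (\<Sum>j\<in>S. (norm (g $ j))\<^sup>2) < (norm (g $ i))\<^sup>2}"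
      proof (rule emeasure_eq_AE)
        show "AE g in gauss. g \<in> {g \<in> space gauss. t < ?X g}
           \<longleftrightarrow> g \<in> {g. s * (\<Sum>j\<in>S. (norm (g $ j))\<^sup>2) < (norm (g $ i))\<^sup>2}"
          using X AE_gauss_nth_neq_0[of i]
        proof eventually_elim
          case (elim g)
          let ?a = "(norm (g $ i))\<^sup>2" and ?b = "\<Sum>j\<in>S. (norm (g $ j))\<^sup>2"
          have "?a > 0" "?b \<ge> 0" using elim by (auto intro: sum_nonneg)
          then have "?a + ?b > 0" by linarith
          then have "t < ?a / (?a + ?b) \<longleftrightarrow> t * ?b < (1 - t) * ?a"
            by (simp add: pos_less_divide_eq algebra_simps)
          also have "\<dots> \<longleftrightarrow> s * ?b < ?a"
            using 2 by (simp add: s_def divide_less_eq mult.commute)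
          finally show ?case using elim by simp
        qed
      qed measurable
      with 2 show ?thesis by (simp add: gauss_ratio_tail[OF s(1) iS] s(2))
    next
      case 3
      have "?X g \<le> 1" for g
      proof -
        have "norm (sphere_point i (insert i S) g $ i) \<le> 1"
          using Finite_Cartesian_Product.norm_nth_le[of "sphere_point i (insert i S) g" i] by simp
        then show ?thesis by (simp add: power_le_one)
      qed
      then have "{g \<in> space gauss. t < ?X g} = {}" using 3 by (auto simp: not_less intro: order_trans)
      with 3 show ?thesis by simp
    qed
  qed
  finally show "emeasure (distr gauss borel ?X) {t<..}
      = ennreal (if t < 0 then 1 else if t < 1 then (1 - t) ^ card S else 0)" .
qed simp

section \<open>The uniform phase and the law of a coordinate\<close>

abbreviation (input) uniform_angle :: "real measure" where
  "uniform_angle \<equiv> uniform_measure lborel {0..2 * pi}"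

text \<open>A half-open period can be cut and shifted without overlaps.\<close>

lemma nn_integral_uniform_angle:
  assumes [measurable]: "f \<in> borel_measurable borel"
  shows "(\<integral>\<^sup>+\<phi>. f \<phi> \<partial>uniform_angle) = (\<integral>\<^sup>+\<phi>. f \<phi> * indicator {0..<2 * pi} \<phi> \<partial>lborel) / ennreal (2 * pi)"
proof -
  have "(\<integral>\<^sup>+\<phi>. f \<phi> * indicator {0..2 * pi} \<phi> \<partial>lborel) = (\<integral>\<^sup>+\<phi>. f \<phi> * indicator {0..<2 * pi} \<phi> \<partial>lborel)"
    using AE_lborel_singleton[of "2 * pi"]
    by (intro nn_integral_cong_AE) (auto split: split_indicator elim!: eventually_mono)
  then show ?thesis by (simp add: nn_integral_uniform_measure)
qed

lemma prob_space_uniform_angle: "prob_space uniform_angle"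
  by (rule prob_space_uniform_measure) auto

lemma measurable_cis [measurable]: "cis \<in> borel_measurable borel"
  by (intro borel_measurable_continuous_onI continuous_intros)

text \<open>Writing w = cis a shifts the window to [a, a + 2 pi); the part beyond 2 pi is moved back
  by one period and fills the gap [0, a).\<close>

lemma uniform_angle_rotate:
  fixes h :: "complex \<Rightarrow> ennreal"
  assumes [measurable]: "h \<in> borel_measurable borel" and w: "norm w = 1"
  shows "(\<integral>\<^sup>+\<phi>. h (cis \<phi> * w) \<partial>uniform_angle) = (\<integral>\<^sup>+\<phi>. h (cis \<phi>) \<partial>uniform_angle)"
proof -
  define a where "a = Arg2pi w"
  have a: "0 \<le> a" "a < 2 * pi" "w = cis a"
    using Arg2pi[of w] Arg2pi_eq[of w] w by (auto simp: a_def cis_conv_exp)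
  have shift: "(\<integral>\<^sup>+\<phi>. f (\<phi> + c) \<partial>lborel) = (\<integral>\<^sup>+\<phi>. f \<phi> \<partial>lborel)"
    if [measurable]: "f \<in> borel_measurable borel" for f :: "real \<Rightarrow> ennreal" and c
    using nn_integral_real_affine[OF that, of 1 c] by (simp add: add.commute)
  have m: "(\<lambda>\<phi>. h (cis \<phi>) * indicator {b..<c} \<phi>) \<in> borel_measurable borel" for b c
    by measurable
  have "(\<integral>\<^sup>+\<phi>. h (cis (\<phi> + a)) * indicator {0..<2 * pi} \<phi> \<partial>lborel)
      = (\<integral>\<^sup>+\<phi>. h (cis (\<phi> + a)) * indicator {a..<a + 2 * pi} (\<phi> + a) \<partial>lborel)"
    by (intro nn_integral_cong) (auto split: split_indicator)
  also have "\<dots> = (\<integral>\<^sup>+\<phi>. h (cis \<phi>) * indicator {a..<a + 2 * pi} \<phi> \<partial>lborel)"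
    by (rule shift[OF m])
  also have "\<dots> = (\<integral>\<^sup>+\<phi>. h (cis \<phi>) * indicator {a..<2 * pi} \<phi> + h (cis \<phi>) * indicator {2 * pi..<a + 2 * pi} \<phi> \<partial>lborel)"
    using a by (intro nn_integral_cong) (auto split: split_indicator)
  also have "\<dots> = (\<integral>\<^sup>+\<phi>. h (cis \<phi>) * indicator {a..<2 * pi} \<phi> \<partial>lborel)
      + (\<integral>\<^sup>+\<phi>. h (cis \<phi>) * indicator {2 * pi..<a + 2 * pi} \<phi> \<partial>lborel)"
    by (intro nn_integral_add) simp_all
  also have "(\<integral>\<^sup>+\<phi>. h (cis \<phi>) * indicator {2 * pi..<a + 2 * pi} \<phi> \<partial>lborel)
      = (\<integral>\<^sup>+\<phi>. h (cis (\<phi> + 2 * pi)) * indicator {2 * pi..<a + 2 * pi} (\<phi> + 2 * pi) \<partial>lborel)"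
    by (rule shift[OF m, symmetric])
  also have "\<dots> = (\<integral>\<^sup>+\<phi>. h (cis \<phi>) * indicator {0..<a} \<phi> \<partial>lborel)"
    by (intro nn_integral_cong) (auto simp: cis.code split: split_indicator)
  also have "(\<integral>\<^sup>+\<phi>. h (cis \<phi>) * indicator {a..<2 * pi} \<phi> \<partial>lborel) + (\<integral>\<^sup>+\<phi>. h (cis \<phi>) * indicator {0..<a} \<phi> \<partial>lborel)
      = (\<integral>\<^sup>+\<phi>. h (cis \<phi>) * indicator {a..<2 * pi} \<phi> + h (cis \<phi>) * indicator {0..<a} \<phi> \<partial>lborel)"
    by (intro nn_integral_add[symmetric]) simp_all
  also have "\<dots> = (\<integral>\<^sup>+\<phi>. h (cis \<phi>) * indicator {0..<2 * pi} \<phi> \<partial>lborel)"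
    using a by (intro nn_integral_cong) (auto split: split_indicator)
  finally show ?thesis
    by (simp add: nn_integral_uniform_angle a(3) cis_mult)
qed

lemma measurable_cnj [measurable]: "cnj \<in> borel_measurable borel"
  by (intro borel_measurable_continuous_onI continuous_intros)

text \<open>By \<open>sphere_point_law\<close> this is the law of minus a coordinate of a uniform
  point on the unit sphere in complex dimension k + 1.\<close>

definition coord_law :: "nat \<Rightarrow> complex measure" where
  "coord_law k = distr (uniform_angle \<Otimes>\<^sub>M beta1_law k) borel (\<lambda>(\<phi>, b). cis \<phi> * of_real (sqrt b))"

lemma sets_coord_law [measurable_cong, simp]: "sets (coord_law k) = sets borel"
  by (simp add: coord_law_def)

lemma mat_cis_unitary: "mat (cis \<phi>) \<in> (unitary_group :: (complex ^ 'n ^ 'n) set)"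
proof (rule unitary_groupI)
  have "mat (cis \<phi>) $ k $ m * cnj (mat (cis \<phi>) $ l $ m) = (if m = k then mat 1 $ k $ l else 0)"
    for k l m :: 'n
    by (simp add: mat_def cis_cnj cis_mult)
  then show "mat (cis \<phi>) ** conj_transpose (mat (cis \<phi>)) = (mat 1 :: complex ^ 'n ^ 'n)"
    by (simp add: vec_eq_iff matrix_matrix_mult_def)
qed

text \<open>Averaging over the scalar matrices \<open>cis \<phi>\<close> randomises the phase of a coordinate and leaves
  its modulus untouched.\<close>
lemma sphere_point_law:
  fixes i :: "'n::finite"
  assumes iS: "i \<notin> S"
  shows "distr gauss borel (\<lambda>g. - sphere_point i (insert i S) g $ i) = coord_law (card S)"
proof (rule measure_eqI)
  fix A :: "complex set" assume "A \<in> sets (distr gauss borel (\<lambda>g. - sphere_point i (insert i S) g $ i))"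
  then have A [measurable]: "A \<in> sets borel" by simp
  interpret G: prob_space "gauss :: (complex ^ 'n) measure" by (rule prob_space_gauss)
  interpret A: prob_space uniform_angle by (rule prob_space_uniform_angle)
  interpret B: prob_space "beta1_law (card S)" by (rule prob_space_beta1_law)
  interpret pair_sigma_finite uniform_angle "gauss :: (complex ^ 'n) measure" ..
  interpret UB: pair_sigma_finite uniform_angle "beta1_law (card S)" ..
  let ?Z = "\<lambda>g. sphere_point i (insert i S) g $ i"
  have rot: "(\<integral>\<^sup>+g. indicator A (- ?Z g) \<partial>gauss) = (\<integral>\<^sup>+g. indicator A (cis \<phi> * ?Z g) \<partial>gauss)" for \<phi>
  proof -
    \<comment> \<open>The extra angle pi absorbs the minus sign.\<close>
    define U :: "complex ^ 'n ^ 'n" where "U = mat (cis (\<phi> + pi))"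
    have U: "U \<in> unitary_group" unfolding U_def by (rule mat_cis_unitary)
    have Ux: "U *v x = cis (\<phi> + pi) *s x" for x
      by (simp add: U_def vec_eq_iff matrix_vector_mult_def mat_def if_distrib if_distribR cong: if_cong)
    have "(\<integral>\<^sup>+g. indicator A (- ?Z g) \<partial>gauss) = (\<integral>\<^sup>+g. indicator A (- ?Z g) \<partial>distr gauss borel ((*v) U))"
      by (simp add: gauss_unitary_invariant[OF U])
    also have "\<dots> = (\<integral>\<^sup>+g. indicator A (- ?Z (U *v g)) \<partial>gauss)"
      by (rule nn_integral_distr) measurable
    also have "\<dots> = (\<integral>\<^sup>+g. indicator A (cis \<phi> * ?Z g) \<partial>gauss)"
    proof (rule nn_integral_cong_AE)
      show "AE g in gauss. indicator A (- ?Z (U *v g)) = (indicator A (cis \<phi> * ?Z g) :: ennreal)"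
        using AE_gauss_nth_neq_0[of i]
      proof eventually_elim
        case (elim g)
        have "coord_proj (insert i S) g $ i \<noteq> 0" using elim by (simp add: coord_proj_def)
        then have "coord_proj (insert i S) g \<noteq> 0" by (metis zero_index)
        moreover have "coord_proj (insert i S) (U *v g) = U *v coord_proj (insert i S) g"
          by (simp add: Ux coord_proj_def vec_eq_iff)
        ultimately have "sphere_point i (insert i S) (U *v g) = U *v sphere_point i (insert i S) g"
          using U by (simp add: sphere_point_def normalise_unitary)
        then have "- ?Z (U *v g) = cis \<phi> * ?Z g"
          by (simp add: Ux flip: cis_mult)
        then show ?case by simp
      qed
    qed
    finally show ?thesis .
  qed
  have [measurable]: "(\<lambda>g. ?Z g) \<in> borel_measurable gauss" by measurable
  have "emeasure (distr gauss borel (\<lambda>g. - ?Z g)) A = (\<integral>\<^sup>+g. indicator A g \<partial>distr gauss borel (\<lambda>g. - ?Z g))"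
    by simp
  also have "\<dots> = (\<integral>\<^sup>+g. indicator A (- ?Z g) \<partial>gauss)"
    by (rule nn_integral_distr) measurable
  \<comment> \<open>The inner integral is constant in the angle, so averaging changes nothing until
    \<open>rot\<close> brings the angle in.\<close>
  also have "\<dots> = (\<integral>\<^sup>+\<phi>. \<integral>\<^sup>+g. indicator A (- ?Z g) \<partial>gauss \<partial>uniform_angle)"
    by (simp add: A.emeasure_space_1[simplified])
  also have "\<dots> = (\<integral>\<^sup>+\<phi>. \<integral>\<^sup>+g. indicator A (cis \<phi> * ?Z g) \<partial>gauss \<partial>uniform_angle)"
    by (rule nn_integral_cong) (rule rot)
  also have "\<dots> = (\<integral>\<^sup>+g. \<integral>\<^sup>+\<phi>. indicator A (cis \<phi> * ?Z g) \<partial>uniform_angle \<partial>gauss)"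
    by (rule Fubini'[symmetric]) measurable
  \<comment> \<open>For fixed g the phase of the coordinate is absorbed by the uniform angle. The
    modulus is written as the root of its square because \<open>sphere_point_sq_law\<close> concerns
    the square.\<close>
  also have "\<dots> = (\<integral>\<^sup>+g. \<integral>\<^sup>+\<phi>. indicator A (cis \<phi> * of_real (sqrt ((norm (?Z g))\<^sup>2))) \<partial>uniform_angle \<partial>gauss)"
  proof (rule nn_integral_cong)
    fix g
    obtain w where w: "norm w = 1" "?Z g = w * of_real (norm (?Z g))"
      using Arg2pi_eq[of "?Z g"] by (metis cis_conv_exp mult.commute norm_cis)
    have "(\<integral>\<^sup>+\<phi>. indicator A (cis \<phi> * ?Z g) \<partial>uniform_angle)
        = (\<integral>\<^sup>+\<phi>. indicator A ((cis \<phi> * w) * of_real (norm (?Z g))) \<partial>uniform_angle)"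
      using w(2) by (metis mult.assoc)
    also have "\<dots> = (\<integral>\<^sup>+\<phi>. indicator A (cis \<phi> * of_real (norm (?Z g))) \<partial>uniform_angle)"
      by (rule uniform_angle_rotate[OF _ w(1), where h = "\<lambda>z. indicator A (z * of_real (norm (?Z g)))"]) measurable
    finally show "(\<integral>\<^sup>+\<phi>. indicator A (cis \<phi> * ?Z g) \<partial>uniform_angle)
       = (\<integral>\<^sup>+\<phi>. indicator A (cis \<phi> * of_real (sqrt ((norm (?Z g))\<^sup>2))) \<partial>uniform_angle)"
      by simp
  qed
  also have "\<dots> = (\<integral>\<^sup>+b. \<integral>\<^sup>+\<phi>. indicator A (cis \<phi> * of_real (sqrt b)) \<partial>uniform_angle
      \<partial>distr gauss borel (\<lambda>g. (norm (?Z g))\<^sup>2))"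
    by (rule nn_integral_distr[symmetric]) measurable
  also have "\<dots> = (\<integral>\<^sup>+b. \<integral>\<^sup>+\<phi>. indicator A (cis \<phi> * of_real (sqrt b)) \<partial>uniform_angle \<partial>beta1_law (card S))"
    by (simp only: sphere_point_sq_law[OF iS])
  also have "\<dots> = (\<integral>\<^sup>+p. indicator A (case p of (\<phi>, b) \<Rightarrow> cis \<phi> * of_real (sqrt b)) \<partial>(uniform_angle \<Otimes>\<^sub>M beta1_law (card S)))"
    by (subst UB.nn_integral_snd[symmetric]) simp_all
  also have "\<dots> = (\<integral>\<^sup>+z. indicator A z \<partial>coord_law (card S))"
    unfolding coord_law_def by (rule nn_integral_distr[symmetric]) measurable
  also have "\<dots> = emeasure (coord_law (card S)) A"
    by simp
  finally show "emeasure (distr gauss borel (\<lambda>g. - ?Z g)) A = emeasure (coord_law (card S)) A" .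
qed simp

text \<open>The common law of both sides of the theorem. One recursion step corresponds to adjoining
  an index to the block, and to splitting the last factor off the product.\<close>

primrec char_det_law :: "nat \<Rightarrow> complex measure" where
  "char_det_law 0 = return borel 1"
| "char_det_law (Suc k) = distr (coord_law k \<Otimes>\<^sub>M char_det_law k) borel (\<lambda>(w, z). (1 + w) * z)"

section \<open>Measurability of the matrix operations\<close>

lemma sets_char_det_law [measurable_cong, simp]: "sets (char_det_law k) = sets borel"
  by (cases k) simp_all

lemma borel_measurable_matI:
  fixes f :: "'b \<Rightarrow> complex ^ 'n ^ 'm"
  assumes "\<And>k l. (\<lambda>x. f x $ k $ l) \<in> borel_measurable M"
  shows "f \<in> borel_measurable M"
  by (intro borel_measurable_vecI assms)

lemma measurable_matrix_mult [measurable (raw)]: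
  fixes f :: "'b \<Rightarrow> complex ^ 'n ^ 'm" and g :: "'b \<Rightarrow> complex ^ 'k ^ 'n"
  assumes [measurable]: "f \<in> borel_measurable M" "g \<in> borel_measurable M"
  shows "(\<lambda>x. f x ** g x) \<in> borel_measurable M"
  by (rule borel_measurable_matI) (simp add: matrix_matrix_mult_def)

lemma measurable_conj_transpose [measurable]:
  "conj_transpose \<in> borel_measurable (borel :: (complex ^ 'n ^ 'm) measure)"
  by (rule borel_measurable_matI) simp

lemma measurable_det [measurable]:
  "det \<in> borel_measurable (borel :: (complex ^ 'n ^ 'n) measure)"
  unfolding det_def by measurable

lemma measurable_minor_det [measurable]:
  fixes S :: "'n::finite set"
  shows "minor_det S \<in> borel_measurable borel"
proof -
  have [measurable]: "(\<lambda>W. \<chi> k l. (if k = l then 1 else 0) - (if l \<in> S then W $ k $ l else 0)) \<in> borel_measurable (borel :: (complex ^ 'n ^ 'n) measure)"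
    by (rule borel_measurable_matI) simp
  show ?thesis unfolding minor_det_def by measurable
qed

lemma measurable_reflect [measurable]: "reflect i \<in> borel_measurable borel"
  by (rule borel_measurable_matI) (simp add: reflect_def)

lemma closed_fix_unitary: "closed (fix_unitary S)"
  unfolding fix_unitary_def unitary_group_def vec_eq_iff matrix_matrix_mult_def
  by (simp add: conj_transpose_def)
     (intro closed_Collect_conj closed_Collect_all closed_Collect_imp closed_Collect_eq open_Collect_const continuous_intros)

lemma sets_fix_unitary [measurable]: "fix_unitary S \<in> sets borel"
  using closed_fix_unitary by (rule borel_closed)

subsection \<open>Haar measure on the block subgroups\<close>

text \<open>The measure lives on all matrices and is merely concentrated on the subgroup, so that
  the measures for different \<open>S\<close> share one measurable space.\<close>

definition haar_on :: "'n set \<Rightarrow> (complex ^ 'n ^ 'n) measure \<Rightarrow> bool" where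
  "haar_on S \<nu> \<longleftrightarrow> prob_space \<nu> \<and> sets \<nu> = sets borel \<and> (AE W in \<nu>. W \<in> fix_unitary S) \<and>
     (\<forall>U\<in>fix_unitary S. distr \<nu> borel ((**) U) = \<nu>)"

text \<open>Invariance needs both sources of randomness: W absorbs the cocycle and g absorbs
  \<open>U\<close>. For the determinant, \<open>minor_det_reflect\<close> gives a function of g
  times a function of W, which are independent on the product space.\<close>

lemma haar_on_reflect:
  fixes \<nu> :: "(complex ^ 'n ^ 'n) measure"
  assumes \<nu>: "haar_on S \<nu>" and iS: "i \<notin> S"
  defines "\<nu>' \<equiv> distr (gauss \<Otimes>\<^sub>M \<nu>) borel (\<lambda>(g, W). reflect i (sphere_point i (insert i S) g) ** W)"
  shows "haar_on (insert i S) \<nu>'"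
    and "distr \<nu>' borel (minor_det (insert i S))
       = distr (coord_law (card S) \<Otimes>\<^sub>M distr \<nu> borel (minor_det S)) borel (\<lambda>(w, z). (1 + w) * z)"
proof -
  let ?x = "sphere_point i (insert i S)"
  let ?R = "\<lambda>g. reflect i (?x g)"
  have sets [measurable_cong, simp]: "sets \<nu> = sets borel" using \<nu> by (simp add: haar_on_def)
  have space [simp]: "space \<nu> = UNIV" using sets_eq_imp_space_eq[OF sets] by simp
  interpret N: prob_space \<nu> using \<nu> by (simp add: haar_on_def)
  interpret G: prob_space "gauss :: (complex ^ 'n) measure" by (rule prob_space_gauss)
  interpret pair_prob_space "gauss :: (complex ^ 'n) measure" \<nu> ..
  have AE\<nu>: "AE W in \<nu>. W \<in> fix_unitary S" using \<nu> by (simp add: haar_on_def)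
  have AEp: "AE p in (gauss :: (complex ^ 'n) measure) \<Otimes>\<^sub>M \<nu>. snd p \<in> fix_unitary S"
  proof (rule AE_pair_measure)
    show "{p \<in> space ((gauss :: (complex ^ 'n) measure) \<Otimes>\<^sub>M \<nu>). snd p \<in> fix_unitary S} \<in> sets (gauss \<Otimes>\<^sub>M \<nu>)"
      by measurable
  qed (use AE\<nu> in simp)
  have RM [measurable]: "?R \<in> borel_measurable borel" by measurable
  have M [measurable]: "(\<lambda>(g, W). ?R g ** W) \<in> borel_measurable (gauss \<Otimes>\<^sub>M \<nu>)"
    by measurable
  have R: "?R g \<in> fix_unitary (insert i S)" for g
    by (intro reflect_fix_unitary) (auto intro: sphere_point_support)
  have "prob_space \<nu>'" unfolding \<nu>'_def by (rule prob_space_distr) (rule M)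
  moreover have "AE W in \<nu>'. W \<in> fix_unitary (insert i S)"
    unfolding \<nu>'_def
  proof (subst AE_distr_iff[OF M])
    show "AE p in gauss \<Otimes>\<^sub>M \<nu>. (case p of (g, W) \<Rightarrow> ?R g ** W) \<in> fix_unitary (insert i S)"
      using AEp
    proof eventually_elim
      case (elim p)
      then show ?case
        using fix_unitary_mono[of S "insert i S"] R
        by (auto simp: case_prod_beta intro: fix_unitary_mult)
    qed
  qed simp
  moreover have "distr \<nu>' borel ((**) U) = \<nu>'" if U: "U \<in> fix_unitary (insert i S)" for U
  proof (rule measure_eqI)
    fix A assume "A \<in> sets (distr \<nu>' borel ((**) U))"
    then have A [measurable]: "A \<in> sets borel" by simp
    have em: "emeasure (distr \<nu> borel ((**) B)) A = (\<integral>\<^sup>+W. indicator A (B ** W) \<partial>\<nu>)" for B :: "complex ^ 'n ^ 'n"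
    proof -
      have "emeasure (distr \<nu> borel ((**) B)) A = (\<integral>\<^sup>+W. indicator A W \<partial>distr \<nu> borel ((**) B))" by simp
      also have "\<dots> = (\<integral>\<^sup>+W. indicator A (B ** W) \<partial>\<nu>)" by (rule nn_integral_distr) measurable
      finally show ?thesis .
    qed
    have "emeasure (distr \<nu>' borel ((**) U)) A = (\<integral>\<^sup>+X. indicator A X \<partial>distr \<nu>' borel ((**) U))" by simp
    also have "\<dots> = (\<integral>\<^sup>+X. indicator A (U ** X) \<partial>\<nu>')"
      by (rule nn_integral_distr) (simp_all add: \<nu>'_def)
    also have "\<dots> = (\<integral>\<^sup>+p. indicator A (U ** (case p of (g, W) \<Rightarrow> ?R g ** W)) \<partial>(gauss \<Otimes>\<^sub>M \<nu>))"
      unfolding \<nu>'_def by (rule nn_integral_distr[OF M]) measurable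
    also have "\<dots> = (\<integral>\<^sup>+g. \<integral>\<^sup>+W. indicator A (U ** (?R g ** W)) \<partial>\<nu> \<partial>gauss)"
      by (subst N.nn_integral_fst[symmetric]) (simp_all add: case_prod_beta)
    also have "\<dots> = (\<integral>\<^sup>+g. \<integral>\<^sup>+W. indicator A (?R (U *v g) ** W) \<partial>\<nu> \<partial>gauss)"
    proof (rule nn_integral_cong_AE)
      show "AE g in gauss. (\<integral>\<^sup>+W. indicator A (U ** (?R g ** W)) \<partial>\<nu>) = (\<integral>\<^sup>+W. indicator A (?R (U *v g) ** W) \<partial>\<nu>)"
        using AE_gauss_nth_neq_0[of i]
      proof eventually_elim
        case (elim g)
        \<comment> \<open>K varies with g but not with W, so the inner integral over W removes it by
          invariance of \<nu>.\<close>
        have "\<exists>K\<in>fix_unitary S. U ** ?R g = reflect i (U *v ?x g) ** K"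
          using U iS by (rule reflect_cocycle) (auto intro: sphere_point_support)
        then obtain K where K: "K \<in> fix_unitary S" "U ** ?R g = ?R (U *v g) ** K"
          using sphere_point_unitary[OF U _ elim] by auto
        have "(\<integral>\<^sup>+W. indicator A (U ** (?R g ** W)) \<partial>\<nu>) = (\<integral>\<^sup>+W. indicator A (?R (U *v g) ** (K ** W)) \<partial>\<nu>)"
          by (simp add: matrix_mul_assoc K(2))
        also have "\<dots> = (\<integral>\<^sup>+W. indicator A (?R (U *v g) ** W) \<partial>distr \<nu> borel ((**) K))"
          by (rule nn_integral_distr[symmetric]) measurable
        also have "distr \<nu> borel ((**) K) = \<nu>" using \<nu> K(1) by (simp add: haar_on_def)
        finally show ?case .
      qed
    qed
    \<comment> \<open>Now \<open>U\<close> acts on g alone and is removed by unitary invariance of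
      the Gaussian law.\<close>
    also have "\<dots> = (\<integral>\<^sup>+g. \<integral>\<^sup>+W. indicator A (?R g ** W) \<partial>\<nu> \<partial>distr gauss borel ((*v) U))"
      by (rule nn_integral_distr[symmetric]) measurable
    also have "distr gauss borel ((*v) U) = gauss"
      using U by (intro gauss_unitary_invariant fix_unitary_unitary)
    also have "(\<integral>\<^sup>+g. \<integral>\<^sup>+W. indicator A (?R g ** W) \<partial>\<nu> \<partial>gauss)
        = (\<integral>\<^sup>+p. indicator A (case p of (g, W) \<Rightarrow> ?R g ** W) \<partial>(gauss \<Otimes>\<^sub>M \<nu>))"
      by (subst N.nn_integral_fst[symmetric]) (simp_all add: case_prod_beta)
    also have "\<dots> = (\<integral>\<^sup>+X. indicator A X \<partial>\<nu>')"
      unfolding \<nu>'_def by (rule nn_integral_distr[OF M, symmetric]) measurable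
    also have "\<dots> = emeasure \<nu>' A" by (simp add: \<nu>'_def)
    finally show "emeasure (distr \<nu>' borel ((**) U)) A = emeasure \<nu>' A" .
  qed (simp add: \<nu>'_def)
  ultimately show "haar_on (insert i S) \<nu>'"
    by (simp add: haar_on_def) (simp add: \<nu>'_def)
  have "distr \<nu>' borel (minor_det (insert i S))
      = distr (gauss \<Otimes>\<^sub>M \<nu>) borel (minor_det (insert i S) \<circ> (\<lambda>(g, W). ?R g ** W))"
    unfolding \<nu>'_def by (rule distr_distr) measurable
  also have "\<dots> = distr (gauss \<Otimes>\<^sub>M \<nu>) borel (\<lambda>(g, W). (1 + - ?x g $ i) * minor_det S W)"
  proof (rule distr_cong_AE)
    show "AE p in gauss \<Otimes>\<^sub>M \<nu>. (minor_det (insert i S) \<circ> (\<lambda>(g, W). ?R g ** W)) p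
        = (case p of (g, W) \<Rightarrow> (1 + - ?x g $ i) * minor_det S W)"
      using AEp
    proof eventually_elim
      case (elim p)
      then show ?case
        using iS by (simp add: case_prod_beta minor_det_reflect)
    qed
  qed measurable
  also have "\<dots> = distr (distr (gauss \<Otimes>\<^sub>M \<nu>) (borel \<Otimes>\<^sub>M borel) (\<lambda>(g, W). (- ?x g $ i, minor_det S W)))
      borel (\<lambda>(w, z). (1 + w) * z)"
    by (subst distr_distr) (auto simp: comp_def case_prod_unfold)
  also have "distr (gauss \<Otimes>\<^sub>M \<nu>) (borel \<Otimes>\<^sub>M borel) (\<lambda>(g, W). (- ?x g $ i, minor_det S W))
      = distr gauss borel (\<lambda>g. - ?x g $ i) \<Otimes>\<^sub>M distr \<nu> borel (minor_det S)"
    by (intro pair_measure_distr[symmetric] prob_space_imp_sigma_finite N.prob_space_distr) measurable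
  finally show "distr \<nu>' borel (minor_det (insert i S))
       = distr (coord_law (card S) \<Otimes>\<^sub>M distr \<nu> borel (minor_det S)) borel (\<lambda>(w, z). (1 + w) * z)"
    by (simp only: sphere_point_law[OF iS])
qed

text \<open>Indices are adjoined one at a time, starting from the point mass at the identity. The
  determinant law of the constructed measure is carried along; \<open>haar_on_unique\<close>
  transfers it to any Haar measure.\<close>

lemma haar_on_exists:
  fixes S :: "'n::finite set"
  shows "\<exists>\<nu>. haar_on S \<nu> \<and> distr \<nu> borel (minor_det S) = char_det_law (card S)"
proof (induction S rule: finite_induct[OF finite])
  case 1
  have eq: "fix_unitary {} = {mat 1 :: complex ^ 'n ^ 'n}"
  proof -
    have "(mat 1 :: complex ^ 'n ^ 'n) \<in> unitary_group" by (simp add: unitary_group_def)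
    then show ?thesis by (auto simp: fix_unitary_def vec_eq_iff) (simp_all add: mat_def)
  qed
  have "haar_on {} (return borel (mat 1 :: complex ^ 'n ^ 'n))"
    by (simp add: haar_on_def prob_space_return eq AE_return distr_return)
  moreover have "distr (return borel (mat 1 :: complex ^ 'n ^ 'n)) borel (minor_det {}) = return borel 1"
    by (subst distr_return) auto
  ultimately show ?case by (intro exI conjI) (auto simp del: minor_det_empty)
next
  case (2 i S)
  then obtain \<nu> where \<nu>: "haar_on S \<nu>" "distr \<nu> borel (minor_det S) = char_det_law (card S)" by blast
  then show ?case
    using haar_on_reflect[OF \<nu>(1) \<open>i \<notin> S\<close>] 2 by (intro exI conjI) auto
qed

text \<open>Integrating \<open>indicator A (conj_transpose X ** Y)\<close> over \<open>\<mu> \<Otimes>\<^sub>M \<nu>\<close> in the two orders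
  expresses \<open>\<nu> A\<close> through \<open>\<mu>\<close> alone.\<close>
lemma haar_on_unique:
  fixes \<mu> \<nu> :: "(complex ^ 'n ^ 'n) measure"
  assumes \<mu>: "haar_on S \<mu>" and \<nu>: "haar_on S \<nu>"
  shows "\<mu> = \<nu>"
proof -
  have eq: "\<nu> = distr \<mu> borel conj_transpose" if \<mu>: "haar_on S \<mu>" and \<nu>: "haar_on S \<nu>" for \<mu> \<nu>
  proof (rule measure_eqI)
    have sets [measurable_cong, simp]: "sets \<mu> = sets borel" "sets \<nu> = sets borel"
      using \<mu> \<nu> by (simp_all add: haar_on_def)
    interpret M: prob_space \<mu> using \<mu> by (simp add: haar_on_def)
    interpret N: prob_space \<nu> using \<nu> by (simp add: haar_on_def)
    interpret pair_sigma_finite \<mu> \<nu> ..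
    show "sets \<nu> = sets (distr \<mu> borel conj_transpose)" by simp
    fix A assume "A \<in> sets \<nu>"
    then have A [measurable]: "A \<in> sets borel" by simp
    have inv: "(\<integral>\<^sup>+Y. f (U ** Y) \<partial>\<rho>) = (\<integral>\<^sup>+Y. f Y \<partial>\<rho>)"
      if \<rho>: "haar_on S \<rho>" and U: "U \<in> fix_unitary S" and f: "f \<in> borel_measurable borel"
      for f :: "complex ^ 'n ^ 'n \<Rightarrow> ennreal" and \<rho> U
    proof -
      have s [measurable_cong]: "sets \<rho> = sets borel" using \<rho> by (simp add: haar_on_def)
      have "(\<integral>\<^sup>+Y. f Y \<partial>distr \<rho> borel ((**) U)) = (\<integral>\<^sup>+Y. f (U ** Y) \<partial>\<rho>)"
        by (rule nn_integral_distr) (use f in measurable)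
      then show ?thesis using \<rho> U by (simp add: haar_on_def)
    qed
    have "emeasure \<nu> A = (\<integral>\<^sup>+X. \<integral>\<^sup>+Y. indicator A Y \<partial>\<nu> \<partial>\<mu>)"
      by (simp add: M.emeasure_space_1)
    also have "\<dots> = (\<integral>\<^sup>+X. \<integral>\<^sup>+Y. indicator A (conj_transpose X ** Y) \<partial>\<nu> \<partial>\<mu>)"
    proof (rule nn_integral_cong_AE)
      have "AE X in \<mu>. X \<in> fix_unitary S" using \<mu> by (simp add: haar_on_def)
      then show "AE X in \<mu>. (\<integral>\<^sup>+Y. indicator A Y \<partial>\<nu>) = (\<integral>\<^sup>+Y. indicator A (conj_transpose X ** Y) \<partial>\<nu>)"
      proof eventually_elim
        case (elim X)
        show ?case
          by (rule inv[OF \<nu> fix_unitary_conj_transpose[OF elim], symmetric]) simp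
      qed
    qed
    also have "\<dots> = (\<integral>\<^sup>+Y. \<integral>\<^sup>+X. indicator A (conj_transpose X ** Y) \<partial>\<mu> \<partial>\<nu>)"
      by (rule Fubini'[symmetric]) measurable
    \<comment> \<open>The argument is the conjugate transpose of
      \<open>conj_transpose Y ** X\<close>, so left invariance of \<mu> removes Y.\<close>
    also have "\<dots> = (\<integral>\<^sup>+Y. \<integral>\<^sup>+X. indicator A (conj_transpose X) \<partial>\<mu> \<partial>\<nu>)"
    proof (rule nn_integral_cong_AE)
      have "AE Y in \<nu>. Y \<in> fix_unitary S" using \<nu> by (simp add: haar_on_def)
      then show "AE Y in \<nu>. (\<integral>\<^sup>+X. indicator A (conj_transpose X ** Y) \<partial>\<mu>) = (\<integral>\<^sup>+X. indicator A (conj_transpose X) \<partial>\<mu>)"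
      proof eventually_elim
        case (elim Y)
        have "(\<integral>\<^sup>+X. indicator A (conj_transpose (conj_transpose Y ** X)) \<partial>\<mu>) = (\<integral>\<^sup>+X. indicator A (conj_transpose X) \<partial>\<mu>)"
        proof -
          have "(\<lambda>X. indicator A (conj_transpose X) :: ennreal) \<in> borel_measurable borel" by measurable
          from inv[OF \<mu> fix_unitary_conj_transpose[OF elim] this] show ?thesis .
        qed
        then show ?case by (simp add: conj_transpose_mult)
      qed
    qed
    also have "\<dots> = (\<integral>\<^sup>+X. indicator A (conj_transpose X) \<partial>\<mu>)"
      by (simp add: N.emeasure_space_1)
    also have "\<dots> = (\<integral>\<^sup>+X. indicator A X \<partial>distr \<mu> borel conj_transpose)"
      by (rule nn_integral_distr[symmetric]) measurable
    finally show "emeasure \<nu> A = emeasure (distr \<mu> borel conj_transpose) A" by simp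
  qed
  \<comment> \<open>Both measures equal the same push-forward of \<mu>.\<close>
  show ?thesis using eq[OF \<mu> \<mu>] eq[OF \<mu> \<nu>] by simp
qed

section \<open>The laws of the determinant and of the product\<close>

lemma measurable_unitary_borelD:
  "V \<in> measurable M unitary_borel \<Longrightarrow> V \<in> borel_measurable M"
  by (simp add: unitary_borel_def measurable_restrict_space2_iff)

lemma unitary_haar_haar_on:
  fixes V :: "'a \<Rightarrow> complex ^ 'n ^ 'n"
  assumes M: "prob_space M" and V: "V \<in> measurable M unitary_borel"
    and haar: "is_unitary_haar (distr M unitary_borel V)"
  shows "haar_on UNIV (distr M borel V)"
proof -
  interpret prob_space M by (rule M)
  have space_ub: "space unitary_borel = (unitary_group :: (complex ^ 'n ^ 'n) set)"
    by (simp add: unitary_borel_def space_restrict_space)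
  have id: "(\<lambda>X. X) \<in> measurable unitary_borel (borel :: (complex ^ 'n ^ 'n) measure)"
    unfolding unitary_borel_def by (rule measurable_restrict_space1) simp
  have Vb [measurable]: "V \<in> borel_measurable M"
    using V by (rule measurable_unitary_borelD)
  have Vu: "V \<omega> \<in> unitary_group" if "\<omega> \<in> space M" for \<omega>
    using measurable_space[OF V that] by (simp add: space_ub)
  have AEV: "AE W in distr M borel V. W \<in> fix_unitary UNIV"
    using Vu by (subst AE_distr_iff[OF Vb]) (auto simp: borel_closed[OF closed_fix_unitary[of UNIV], simplified])
  have "distr (distr M borel V) borel ((**) U) = distr M borel V" if U: "U \<in> unitary_group" for U
  proof -
    have mu: "(**) U \<in> measurable unitary_borel (unitary_borel :: (complex ^ 'n ^ 'n) measure)"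
      unfolding unitary_borel_def
      by (rule measurable_restrict_space2)
         (use U in \<open>auto simp: space_restrict_space intro: unitary_group_mult measurable_restrict_space1\<close>)
    have "distr (distr M unitary_borel V) unitary_borel ((**) U) = distr M unitary_borel V"
      using haar U by (simp add: is_unitary_haar_def)
    \<comment> \<open>Invariance is pushed forward along the inclusion of the group into the space
      of all matrices.\<close>
    then have "distr (distr (distr M unitary_borel V) unitary_borel ((**) U)) borel (\<lambda>X. X)
        = distr (distr M unitary_borel V) borel (\<lambda>X. X)"
      by simp
    then have "distr M borel (\<lambda>\<omega>. U ** V \<omega>) = distr M borel V"
      by (simp add: distr_distr[OF id V] distr_distr[OF mu V] distr_distr[OF id measurable_compose[OF V mu]] comp_def)
    then show ?thesis by (subst distr_distr) (auto simp: comp_def)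
  qed
  then show ?thesis
    using AEV by (auto simp: haar_on_def intro: prob_space_distr)
qed

text \<open>The factor \<open>cis \<theta>\<close> is left multiplication by a scalar unitary matrix
  and disappears by invariance; uniqueness then replaces the law of \<open>V\<close> by the
  constructed Haar measure.\<close>

lemma unitary_char_det_law:
  fixes V :: "'a \<Rightarrow> complex ^ 'n ^ 'n"
  assumes M: "prob_space M" and V: "V \<in> measurable M unitary_borel"
    and haar: "is_unitary_haar (distr M unitary_borel V)"
  shows "distr M borel (\<lambda>\<omega>. det (mat 1 - (\<chi> i j. cis \<theta> * V \<omega> $ i $ j))) = char_det_law CARD('n)"
proof -
  let ?\<mu> = "distr M borel V"
  let ?U = "mat (cis \<theta>) :: complex ^ 'n ^ 'n"
  have \<mu>: "haar_on UNIV ?\<mu>" by (rule unitary_haar_haar_on[OF M V haar])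
  have Vb [measurable]: "V \<in> borel_measurable M"
    using V by (rule measurable_unitary_borelD)
  obtain \<nu> :: "(complex ^ 'n ^ 'n) measure" where \<nu>: "haar_on UNIV \<nu>" "distr \<nu> borel (minor_det UNIV) = char_det_law CARD('n)"
    using haar_on_exists[of "UNIV :: 'n set"] by blast
  have UV: "?U ** W = (\<chi> i j. cis \<theta> * W $ i $ j)" for W
  proof -
    have "?U $ k $ m * W $ m $ l = (if m = k then cis \<theta> * W $ k $ l else 0)" for k l m
      by (simp add: mat_def)
    then show ?thesis by (simp add: vec_eq_iff matrix_matrix_mult_def)
  qed
  have "distr M borel (\<lambda>\<omega>. det (mat 1 - (\<chi> i j. cis \<theta> * V \<omega> $ i $ j)))
      = distr (distr ?\<mu> borel ((**) ?U)) borel (minor_det UNIV)"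
    by (simp add: distr_distr comp_def minor_det_UNIV flip: UV)
  also have "distr ?\<mu> borel ((**) ?U) = ?\<mu>"
    using \<mu> mat_cis_unitary[of \<theta>, where 'n = 'n] by (simp add: haar_on_def)
  also have "?\<mu> = \<nu>" by (rule haar_on_unique[OF \<mu> \<nu>(1)])
  finally show ?thesis using \<nu>(2) by simp
qed

text \<open>Induction on the number of factors. Angles are counted from 1 and beta variables from 0,
  so the factor \<open>Suc n\<close> involves \<open>\<beta> n\<close> and contributes
  \<open>coord_law n\<close>, as the recursion of \<open>char_det_law\<close> demands.\<close>

lemma (in prob_space) distr_indep_prod:
  assumes indep: "indep_vars (\<lambda>_. borel) (case_sum \<theta> \<beta>) ({1..n} <+> {0..<n})"
    and \<theta>: "\<And>k. k \<in> {1..n} \<Longrightarrow> distr M borel (\<theta> k) = uniform_angle"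
    and \<beta>: "\<And>j. j \<in> {0..<n} \<Longrightarrow> distr M borel (\<beta> j) = beta1_law j"
  shows "distr M borel (\<lambda>\<omega>. \<Prod>k=1..n. 1 + cis (\<theta> k \<omega>) * of_real (sqrt (\<beta> (k - 1) \<omega>))) = char_det_law n"
  using assms
proof (induction n)
  case 0
  have "distr M borel (\<lambda>_. 1 :: complex) = return borel 1"
    by (rule distr_const) simp
  then show ?case by simp
next
  case (Suc n)
  let ?W = "\<lambda>\<omega>. cis (\<theta> (Suc n) \<omega>) * complex_of_real (sqrt (\<beta> n \<omega>))"
  let ?P = "\<lambda>\<omega>. \<Prod>k=1..n. 1 + cis (\<theta> k \<omega>) * complex_of_real (sqrt (\<beta> (k - 1) \<omega>))"
  let ?X = "case_sum \<theta> \<beta>"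
  let ?A = "{Inl (Suc n), Inr n} :: (nat + nat) set" and ?B = "{1..n} <+> {0..<n} :: (nat + nat) set"
  have IH: "distr M borel ?P = char_det_law n"
    using Suc.prems by (intro Suc.IH indep_vars_subset[OF Suc.prems(1)]) auto
  \<comment> \<open>Disjoint blocks of an independent family are independent: the last pair against
    all earlier variables.\<close>
  have "indep_var (Pi\<^sub>M ?A (\<lambda>_. borel)) (\<lambda>\<omega>. restrict (\<lambda>i. ?X i \<omega>) ?A)
      (Pi\<^sub>M ?B (\<lambda>_. borel)) (\<lambda>\<omega>. restrict (\<lambda>i. ?X i \<omega>) ?B)"
    by (rule indep_var_restrict[OF Suc.prems(1)]) auto
  then have "indep_var borel ((\<lambda>f. cis (f (Inl (Suc n))) * of_real (sqrt (f (Inr n)))) \<circ> (\<lambda>\<omega>. restrict (\<lambda>i. ?X i \<omega>) ?A))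
     borel ((\<lambda>f. \<Prod>k=1..n. 1 + cis (f (Inl k)) * complex_of_real (sqrt (f (Inr (k - 1))))) \<circ> (\<lambda>\<omega>. restrict (\<lambda>i. ?X i \<omega>) ?B))"
  proof (rule indep_var_compose)
    show "(\<lambda>f. \<Prod>k=1..n. 1 + cis (f (Inl k)) * complex_of_real (sqrt (f (Inr (k - 1)))))
        \<in> borel_measurable (Pi\<^sub>M ?B (\<lambda>_. borel :: real measure))"
    proof (rule borel_measurable_prod)
      fix k assume "k \<in> {1..n}"
      then have [measurable]: "(\<lambda>f. f (Inl k)) \<in> borel_measurable (Pi\<^sub>M ?B (\<lambda>_. borel :: real measure))"
        "(\<lambda>f. f (Inr (k - 1))) \<in> borel_measurable (Pi\<^sub>M ?B (\<lambda>_. borel :: real measure))"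
        by (auto intro!: measurable_component_singleton)
      show "(\<lambda>f. 1 + cis (f (Inl k)) * complex_of_real (sqrt (f (Inr (k - 1)))))
        \<in> borel_measurable (Pi\<^sub>M ?B (\<lambda>_. borel :: real measure))" by measurable
    qed
  qed measurable
  also have "(\<lambda>f. cis (f (Inl (Suc n))) * of_real (sqrt (f (Inr n)))) \<circ> (\<lambda>\<omega>. restrict (\<lambda>i. ?X i \<omega>) ?A) = ?W"
    by (simp add: comp_def)
  also have "(\<lambda>f. \<Prod>k=1..n. 1 + cis (f (Inl k)) * complex_of_real (sqrt (f (Inr (k - 1))))) \<circ> (\<lambda>\<omega>. restrict (\<lambda>i. ?X i \<omega>) ?B) = ?P"
    by (auto simp: comp_def intro!: ext prod.cong)
  finally have WP: "indep_var borel ?W borel ?P" .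
  \<comment> \<open>The same principle with singletons separates the angle from the beta variable
    within the last pair.\<close>
  have "indep_var (Pi\<^sub>M {Inl (Suc n)} (\<lambda>_. borel)) (\<lambda>\<omega>. restrict (\<lambda>i. ?X i \<omega>) {Inl (Suc n)})
      (Pi\<^sub>M {Inr n} (\<lambda>_. borel)) (\<lambda>\<omega>. restrict (\<lambda>i. ?X i \<omega>) {Inr n})"
    by (rule indep_var_restrict[OF Suc.prems(1)]) auto
  then have "indep_var borel ((\<lambda>f. f (Inl (Suc n))) \<circ> (\<lambda>\<omega>. restrict (\<lambda>i. ?X i \<omega>) {Inl (Suc n)}))
     borel ((\<lambda>f. f (Inr n)) \<circ> (\<lambda>\<omega>. restrict (\<lambda>i. ?X i \<omega>) {Inr n}))"
    by (rule indep_var_compose) measurable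
  then have \<theta>\<beta>: "indep_var borel (\<theta> (Suc n)) borel (\<beta> n)"
    by (simp add: comp_def)
  have [measurable]: "\<theta> (Suc n) \<in> borel_measurable M" "\<beta> n \<in> borel_measurable M"
    using \<theta>\<beta> by (auto dest: indep_var_rv1 indep_var_rv2)
  have [measurable]: "?P \<in> borel_measurable M" using WP by (rule indep_var_rv2)
  have "distr M borel ?W = distr (distr M (borel \<Otimes>\<^sub>M borel) (\<lambda>\<omega>. (\<theta> (Suc n) \<omega>, \<beta> n \<omega>))) borel
      (\<lambda>(\<phi>, b). cis \<phi> * of_real (sqrt b))"
    by (subst distr_distr) (auto simp: comp_def)
  also have "distr M (borel \<Otimes>\<^sub>M borel) (\<lambda>\<omega>. (\<theta> (Suc n) \<omega>, \<beta> n \<omega>)) = uniform_angle \<Otimes>\<^sub>M beta1_law n"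
    using \<theta>\<beta> Suc.prems(2)[of "Suc n"] Suc.prems(3)[of n] by (simp add: indep_var_distribution_eq)
  finally have W: "distr M borel ?W = coord_law n" by (simp add: coord_law_def)
  have "distr M borel (\<lambda>\<omega>. \<Prod>k=1..Suc n. 1 + cis (\<theta> k \<omega>) * of_real (sqrt (\<beta> (k - 1) \<omega>)))
      = distr M borel ((\<lambda>(w, z). (1 + w) * z) \<circ> (\<lambda>\<omega>. (?W \<omega>, ?P \<omega>)))"
    by (rule distr_cong) (simp_all add: mult.commute)
  also have "\<dots> = distr (distr M (borel \<Otimes>\<^sub>M borel) (\<lambda>\<omega>. (?W \<omega>, ?P \<omega>))) borel (\<lambda>(w, z). (1 + w) * z)"
    by (rule distr_distr[symmetric]) measurable
  also have "distr M (borel \<Otimes>\<^sub>M borel) (\<lambda>\<omega>. (?W \<omega>, ?P \<omega>)) = coord_law n \<Otimes>\<^sub>M char_det_law n"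
    using WP[unfolded indep_var_distribution_eq W IH] by auto
  finally show ?case by simp
qed

theorem proposition2p2:
  fixes M :: "'a measure" and M' :: "'b measure"
    and V :: "'a \<Rightarrow> complex ^ 'n ^ 'n"
    and \<theta>s :: "nat \<Rightarrow> 'b \<Rightarrow> real" and \<beta> :: "nat \<Rightarrow> 'b \<Rightarrow> real"
    and \<theta> :: real and N :: nat
  assumes N: "N = CARD('n)"
    and M: "prob_space M"
    and V_meas: "V \<in> measurable M unitary_borel"
    and V_haar: "is_unitary_haar (distr M unitary_borel V)"
    and M': "prob_space M'"
    and indep: "prob_space.indep_vars M' (\<lambda>_. borel) (case_sum \<theta>s \<beta>) ({1..N} <+> {0..<N})"
    and \<theta>s_law: "\<And>k. k \<in> {1..N} \<Longrightarrow> distr M' borel (\<theta>s k) = uniform_measure lborel {0..2 * pi}"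
    and \<beta>_law: "\<And>j. j \<in> {0..<N} \<Longrightarrow> distr M' borel (\<beta> j) = beta1_law j"
  shows "distr M borel (\<lambda>\<omega>. det (mat 1 - (\<chi> i j. cis \<theta> * V \<omega> $ i $ j))) =
         distr M' borel (\<lambda>\<omega>. \<Prod>k=1..N. 1 + cis (\<theta>s k \<omega>) * of_real (sqrt (\<beta> (k - 1) \<omega>)))"
  using unitary_char_det_law[OF M V_meas V_haar] prob_space.distr_indep_prod[OF M' indep \<theta>s_law \<beta>_law]
  by (simp add: N)

end
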